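(* Let $p$ be a prime, let $e,n$ be positive integers, let $G$ be a cyclic group of order $p^e$, and let $F$ be a field containing a primitive $p^e$-th root of $1$. Let $\mathcal N(G,n)$ be the number of isomorphism classes of element systems with characters over $G$ (with values in $F$) indexed by $\{1,\dots,n\}$. Below, $\sum_{\lambda}$ denotes the sum over all $n$-tuples $\lambda=(\lambda_1,\dots,\lambda_n)$ of non-negative integers with $\lambda_1+2\lambda_2+\cdots+n\lambda_n=n$, and $z_\lambda:=\lambda_1!\cdots\lambda_n!\,1^{\lambda_1}2^{\lambda_2}\cdots n^{\lambda_n}$. (i) If $p$ is odd or $e\le 2$, then $$\mathcal N(G,n)=\frac{1}{p^{e-1}(p-1)}\sum_{d\mid p-1}\varphi(d)\sum_{\lambda}\frac{p^{2f_{p,e}^{(e,d)}(\lambda)}}{z_\lambda}+\sum_{k=1}^{e-1}p^{-k}\sum_{d\mid p-1}\varphi(d)\sum_{\lambda}\frac{p^{2f_{p,e}^{(k,d)}(\lambda)}}{z_\lambda}$$ $$=1+\frac{1}{p^{e-1}(p-1)}\sum_{\substack{d\mid p-1\\ d\le n}}\varphi(d)\left(\sum_{\lambda}\frac{p^{2e\sum_{t=1}^{[n/d]}\lambda_{td}}}{z_\lambda}-1\right)+\sum_{k=1}^{e-1}p^{-k}\sum_{\substack{d\mid p-1\\ d\le n}}\varphi(d)\left(\sum_{\lambda}\frac{p^{2f_{p,e}^{(k,d)}(\lambda)}}{z_\lambda}-1\right),$$ where, for $1\le k\le e$ and $d\mid p-1$, $$f_{p,e}^{(k,d)}(\lambda)=\sum_{s=0}^{e-k-1}(k+s)\sum_{\substack{1\le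 t\le [n/(p^sd)]\\ (t,p)=1}}\lambda_{tp^sd}+e\sum_{t=1}^{[n/(p^{e-k}d)]}\lambda_{tp^{e-k}d}.$$ (ii) If $p=2$ and $e\ge 3$, then $$\mathcal N(G,n)=\sum_{d=1}^{2}\sum_{k=2}^{e}\frac{\varphi(2^{e-k})}{2^{e-1}}\sum_{\lambda}\frac{4^{f_{2,e}^{(k,d)}(\lambda)}}{z_\lambda}$$ $$=\frac1{2^{e-1}}\sum_{\lambda}\frac{4^{e\sum_{t=1}^n\lambda_t}+4^{\sum_{(t,2)=1}\lambda_t+e\sum_{t=1}^{[n/2]}\lambda_{2t}}}{z_\lambda}+\sum_{d=1}^{2}\sum_{k=2}^{e-1}2^{-k}\sum_{\lambda}\frac{4^{f_{2,e}^{(k,d)}(\lambda)}}{z_\lambda},$$ where $$f_{2,e}^{(k,1)}(\lambda)=\sum_{s=0}^{e-k-1}(k+s)\sum_{\substack{1\le t\le[n/2^s]\\(t,2)=1}}\lambda_{t2^s}+e\sum_{t=1}^{[n/2^{e-k}]}\lambda_{t2^{e-k}}\quad(2\le k\le e),$$ $$f_{2,e}^{(k,2)}(\lambda)=\sum_{(t,2)=1}\lambda_t+\sum_{s=1}^{e-k-1}(k+s)\sum_{\substack{1\le t\le[n/2^s]\\(t,2)=1}}\lambda_{t2^s}+e\sum_{t=1}^{[n/2^{e-k}]}\lambda_{t2^{e-k}}\quad(2\le k\le e-1),$$ $$f_{2,e}^{(e,2)}(\lambda)=\sum_{(t,2)=1}\lambda_t+e\sum_{t=1}^{[n/2]}\lambda_{2t}.$$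 Here $\sum_{(t,2)=1}\lambda_t$ is the sum over odd $t$ with $1\le t\le n$.
   Context: For a finite abelian group $G$ of order $m$ and a field $F$ containing a primitive $m$-th root of $1$, $\widehat G$ denotes the set of characters of $G$, i.e. group homomorphisms $G\to F\setminus\{0\}$. An element system with characters (ESC) over $G$ indexed by a set $J$ is a pair of families $(g_i)_{i\in J}$, $(\chi_i)_{i\in J}$ with $g_i\in G$, $\chi_i\in\widehat G$. Two ESCs $(g_i,\chi_i)_{i\in J}$ over $G$ and $(g_i',\chi_i')_{i\in J'}$ over $G'$ are isomorphic if there are a group isomorphism $\phi:G\to G'$ and a bijection $\sigma:J\to J'$ such that $\phi(g_i)=g'_{\sigma(i)}$ and $\chi'_{\sigma(i)}\circ\phi=\chi_i$ for all $i\in J$. For a positive integer $n$, $\mathcal N(G,n)$ is the number of isomorphism classes of ESCs over $G$ indexed by $J=\{1,\dots,n\}$; equivalently the number of orbits of $\mathrm{Aut}(G)\times S_n$ on the set of all such ESCs. $\varphi$ is Euler's totient function, $[x]$ is the integer part of $x$, $(a,b)$ is the gcd, and empty sums are $0$. *)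

theory Defs
  imports Complex_Main "HOL-Algebra.Multiplicative_Group" "HOL-Algebra.Elementary_Groups" "HOL-Number_Theory.Totient"
begin

definition primitive_root_of_one :: "('b, 'd) ring_scheme \<Rightarrow> nat \<Rightarrow> 'b \<Rightarrow> bool" where
  "primitive_root_of_one F m \<zeta> \<longleftrightarrow>
     \<zeta> \<in> carrier F \<and> \<zeta> [^]\<^bsub>F\<^esub> m = \<one>\<^bsub>F\<^esub> \<and> (\<forall>k::nat. 0 < k \<and> k < m \<longrightarrow> \<zeta> [^]\<^bsub>F\<^esub> k \<noteq> \<one>\<^bsub>F\<^esub>)"

(* Characters and families are taken extensional, so that two of them are equal as soon as they
   agree on carrier G, respectively on the index set. *)

definition characters :: "('a, 'c) monoid_scheme \<Rightarrow> ('b, 'd) ring_scheme \<Rightarrow> ('a \<Rightarrow> 'b) set" where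
  "characters G F = hom G (mult_of F) \<inter> extensional (carrier G)"

definition ESC :: "('a, 'c) monoid_scheme \<Rightarrow> ('b, 'd) ring_scheme \<Rightarrow> 'i set
    \<Rightarrow> (('i \<Rightarrow> 'a) \<times> ('i \<Rightarrow> 'a \<Rightarrow> 'b)) set" where
  "ESC G F J = (J \<rightarrow>\<^sub>E carrier G) \<times> (J \<rightarrow>\<^sub>E characters G F)"

definition ESC_isomorphic ::
    "('a, 'c) monoid_scheme \<Rightarrow> 'i set \<Rightarrow> ('i \<Rightarrow> 'a) \<times> ('i \<Rightarrow> 'a \<Rightarrow> 'b)
     \<Rightarrow> ('e, 'f) monoid_scheme \<Rightarrow> 'j set \<Rightarrow> ('j \<Rightarrow> 'e) \<times> ('j \<Rightarrow> 'e \<Rightarrow> 'b) \<Rightarrow> bool" where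
  "ESC_isomorphic G J = (\<lambda>(g, \<chi>) G' J' (g', \<chi>').
     \<exists>\<phi> \<in> iso G G'. \<exists>\<sigma>. bij_betw \<sigma> J J' \<and>
       (\<forall>i\<in>J. \<phi> (g i) = g' (\<sigma> i) \<and> (\<forall>x\<in>carrier G. \<chi>' (\<sigma> i) (\<phi> x) = \<chi> i x)))"

definition num_ESC_classes ::
    "('a, 'c) monoid_scheme \<Rightarrow> ('b, 'd) ring_scheme \<Rightarrow> nat \<Rightarrow> nat" where
  "num_ESC_classes G F n =
     card (ESC G F {1..n} //
       {(A, B). A \<in> ESC G F {1..n} \<and> B \<in> ESC G F {1..n} \<and>
                ESC_isomorphic G {1..n} A G {1..n} B})"

(* The tuples (l 1, ..., l n), i.e. the cycle types of permutations of n letters. *)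

definition cycle_types :: "nat \<Rightarrow> (nat \<Rightarrow> nat) set" where
  "cycle_types n = {l \<in> {1..n} \<rightarrow>\<^sub>E UNIV. (\<Sum>i=1..n. i * l i) = n}"

definition z_cycle :: "nat \<Rightarrow> (nat \<Rightarrow> nat) \<Rightarrow> nat" where
  "z_cycle n l = (\<Prod>i=1..n. fact (l i)) * (\<Prod>i=1..n. i ^ l i)"

(* In the sums over s, the upper limit e - k - 1 is inclusive and equals -1 for k = e; it is
   written as s < e - k because subtraction on nat truncates. *)

definition f_exp :: "nat \<Rightarrow> nat \<Rightarrow> nat \<Rightarrow> nat \<Rightarrow> nat \<Rightarrow> (nat \<Rightarrow> nat) \<Rightarrow> nat" where
  "f_exp p e n k d l =
     (\<Sum>s<e - k. (k + s) * (\<Sum>t | t \<in> {1..n div (p ^ s * d)} \<and> coprime t p. l (t * p ^ s * d)))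
     + e * (\<Sum>t = 1..n div (p ^ (e - k) * d). l (t * p ^ (e - k) * d))"

(* The separate exponents for p = 2 and e > 2, used for d = 1, 2 and k = 2, ..., e. *)

definition f2_exp :: "nat \<Rightarrow> nat \<Rightarrow> nat \<Rightarrow> nat \<Rightarrow> (nat \<Rightarrow> nat) \<Rightarrow> nat" where
  "f2_exp e n k d l =
    (if d = 1 then
       (\<Sum>s<e - k. (k + s) * (\<Sum>t | t \<in> {1..n div 2 ^ s} \<and> coprime t 2. l (t * 2 ^ s)))
       + e * (\<Sum>t = 1..n div 2 ^ (e - k). l (t * 2 ^ (e - k)))
     else if k < e then
       (\<Sum>t | t \<in> {1..n} \<and> coprime t 2. l t)
       + (\<Sum>s\<in>{1..<e - k}. (k + s) * (\<Sum>t | t \<in> {1..n div 2 ^ s} \<and> coprime t 2. l (t * 2 ^ s)))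
       + e * (\<Sum>t = 1..n div 2 ^ (e - k). l (t * 2 ^ (e - k)))
     else
       (\<Sum>t | t \<in> {1..n} \<and> coprime t 2. l t) + e * (\<Sum>t = 1..n div 2. l (2 * t)))"

end

theory Submission
  imports Defs
    "HOL-Combinatorics.Cycles"
    "HOL-Number_Theory.Residue_Primitive_Roots"
    "HOL-Algebra.Group_Action"
    "HOL-Algebra.Polynomial_Divisibility"
begin

text \<open>
  Up to the choice of a generator of \<open>G\<close> and of a primitive root in \<open>F\<close>, an element with a
  character is a pair \<open>(i, j)\<close> modulo \<open>m = p\<^sup>e\<close>, on which the automorphism \<open>x \<mapsto> x\<^sup>a\<close> acts by
  \<open>(i, j) \<mapsto> (a i, a\<^sup>-\<^sup>1 j)\<close>. Forgetting the order of the indices turns an element system into a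
  multiset of \<open>n\<close> such pairs, so the isomorphism classes are the orbits of the units modulo \<open>m\<close>
  on these multisets, and Burnside's lemma applies.

  For a permutation \<open>f\<close> let \<open>h(n)\<close> be the number of \<open>f\<close>-invariant multisets of size \<open>n\<close> and
  \<open>c(j)\<close> the number of fixed points of \<open>f\<^sup>j\<close>. Counting the elements of all these multisets, and
  removing copies of an orbit from a multiset, gives \<open>n h(n) = \<Sum>j. c(j) h(n - j)\<close>; the cycle
  index sum over the tuples \<open>\<lambda>\<close> satisfies the same recurrence. This avoids counting the
  permutations of a given cycle type. For the unit \<open>a\<close> one has \<open>c(j) = gcd(a\<^sup>j - 1, m)\<^sup>2\<close>.

  It remains to sort the units by the valuations of \<open>a\<^sup>j - 1\<close>. If the unit group is cyclic these
  are determined by the order of \<open>a\<close>, since \<open>p\<^sup>i\<close> divides \<open>a\<^sup>j - 1\<close> exactly when the order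
  divides \<open>j p\<^sup>e\<^sup>-\<^sup>i\<close>. For \<open>p = 2\<close> one writes \<open>a = \<plusminus>b\<close> with \<open>b \<equiv> 1\<close> modulo \<open>4\<close> and lifts the
  exponent.
\<close>
section \<open>Multisets fixed by a permutation\<close>

definition invariant_msets :: "'a set \<Rightarrow> ('a \<Rightarrow> 'a) \<Rightarrow> nat \<Rightarrow> 'a multiset set" where
  "invariant_msets Y f n = {M \<in> multisets_of_size Y n. image_mset f M = M}"

lemma finite_invariant_msets: "finite Y \<Longrightarrow> finite (invariant_msets Y f n)"
  by (simp add: invariant_msets_def finite_multisets_of_size)

lemma invariant_msets_0 [simp]: "invariant_msets Y f 0 = {{#}}"
  by (auto simp: invariant_msets_def)

lemma count_image_mset_inj_apply: "inj f \<Longrightarrow> count (image_mset f M) (f x) = count M x"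
proof -
  assume "inj f"
  then have "{y. y \<in># M \<and> f x = f y} = (if x \<in># M then {x} else {})"
    by (auto dest: injD)
  then show ?thesis
    by (simp add: count_image_mset' not_in_iff)
qed

lemma image_mset_eq_self_iff:
  assumes "bij f"
  shows "image_mset f M = M \<longleftrightarrow> (\<forall>x. count M (f x) = count M x)"
proof
  assume "image_mset f M = M"
  then show "\<forall>x. count M (f x) = count M x"
    using count_image_mset_inj_apply[OF bij_is_inj[OF assms], of M] by simp
next
  assume *: "\<forall>x. count M (f x) = count M x"
  show "image_mset f M = M"
  proof (rule multiset_eqI)
    fix y
    obtain x where "y = f x" using assms by (metis bij_pointE)
    then show "count (image_mset f M) y = count M y"
      using * count_image_mset_inj_apply[OF bij_is_inj[OF assms], of M x] by simp
  qed
qed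

lemma count_funpow_invariant:
  assumes "bij f" "image_mset f M = M"
  shows "count M ((f ^^ i) x) = count M x"
  using assms by (induction i) (auto simp: image_mset_eq_self_iff)

lemma card_invariant_msets_count_ge:
  assumes "finite Y" "f permutes Y" "x \<in> Y" "k > 0"
  shows "card {M \<in> invariant_msets Y f n. k \<le> count M x} =
    (if k * least_power f x \<le> n then card (invariant_msets Y f (n - k * least_power f x)) else 0)"
proof -
  have perm: "permutation f" using assms(1,2) by (auto simp: permutation_permutes)
  have bij: "bij f" using assms(2) by (rule permutes_bij)
  \<comment> \<open>An invariant multiset has constant multiplicity on the orbit of \<open>x\<close>, so \<open>k\<close> copies of that
    orbit can be removed from it.\<close>
  define Q where "Q = mset_set (set (support f x))"
  have dist: "distinct (support f x)" using cycle_of_permutation[OF perm] .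
  have set_eq: "set (support f x) = range (\<lambda>i. (f ^^ i) x)"
    by (rule support_set[OF perm])
  have cnt: "count Q y = (if y \<in> range (\<lambda>i. (f ^^ i) x) then 1 else 0)" for y
    unfolding Q_def by (simp only: count_mset_set' finite_set set_eq) (simp add: set_eq[symmetric])
  have size_Q: "size Q = least_power f x"
    unfolding Q_def using distinct_card[OF dist] by simp
  have in_range: "f y \<in> range (\<lambda>i. (f ^^ i) x) \<longleftrightarrow> y \<in> range (\<lambda>i. (f ^^ i) x)" for y
  proof
    assume "y \<in> range (\<lambda>i. (f ^^ i) x)"
    then obtain i where "y = (f ^^ i) x" by auto
    then have "f y = (f ^^ Suc i) x" by simp
    then show "f y \<in> range (\<lambda>i. (f ^^ i) x)" by blast
  next
    assume "f y \<in> range (\<lambda>i. (f ^^ i) x)"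
    then obtain i where i: "f y = (f ^^ i) x" by auto
    \<comment> \<open>Adding the period to the exponent makes it positive, so that one
      \<open>f\<close> can be split off and cancelled by injectivity even if
      \<open>i = 0\<close>.\<close>
    define r where "r = least_power f x"
    have r: "(f ^^ r) x = x" "r > 0"
      using least_power_of_permutation[OF perm] by (auto simp: r_def)
    have "f y = (f ^^ (i + r)) x" by (simp add: funpow_add r i)
    also have "\<dots> = f ((f ^^ (i + r - 1)) x)"
      using r(2) by (metis Suc_pred' add_gr_0 funpow.simps(2) o_apply)
    finally have "y = (f ^^ (i + r - 1)) x"
      using bij_is_inj[OF bij] by (simp add: inj_eq)
    then show "y \<in> range (\<lambda>i. (f ^^ i) x)" by blast
  qed
  have Q_inv: "image_mset f (repeat_mset k Q) = repeat_mset k Q"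
    using in_range by (simp add: image_mset_eq_self_iff[OF bij] cnt)
  have Q_sub: "set_mset Q \<subseteq> Y"
  proof -
    have "(f ^^ i) x \<in> Y" for i
      using assms(2,3) by (induction i) (auto simp: permutes_in_image)
    then show ?thesis unfolding Q_def by (auto simp: set_eq)
  qed
  then have Q_sub': "set_mset (repeat_mset k Q) \<subseteq> Y"
    by (auto simp flip: count_greater_zero_iff)
  \<comment> \<open>Invariance spreads the multiplicity of \<open>x\<close> over its whole orbit, so
    \<open>k\<close> copies of the point already force \<open>k\<close> copies of the orbit.\<close>
  have sub_iff: "k \<le> count M x \<longleftrightarrow> repeat_mset k Q \<subseteq># M" if "M \<in> invariant_msets Y f n" for M
  proof
    assume k: "k \<le> count M x"
    show "repeat_mset k Q \<subseteq># M"
    proof (rule mset_subset_eqI)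
      fix y
      show "count (repeat_mset k Q) y \<le> count M y"
        using k count_funpow_invariant[OF bij, of M] that
        by (auto simp: cnt invariant_msets_def)
    qed
  next
    assume "repeat_mset k Q \<subseteq># M"
    then have "count (repeat_mset k Q) x \<le> count M x" by (rule mset_subset_eq_count)
    moreover have "x \<in> range (\<lambda>i. (f ^^ i) x)" by (rule range_eqI[of _ _ 0]) simp
    ultimately show "k \<le> count M x" by (simp add: cnt)
  qed
  show ?thesis
  proof (cases "k * least_power f x \<le> n")
    case True
    have "bij_betw (\<lambda>M. M + repeat_mset k Q) (invariant_msets Y f (n - k * least_power f x))
            {M \<in> invariant_msets Y f n. k \<le> count M x}"
    proof (rule bij_betw_byWitness[where f' = "\<lambda>M. M - repeat_mset k Q"])
      show "(\<lambda>M. M + repeat_mset k Q) ` invariant_msets Y f (n - k * least_power f x)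
          \<subseteq> {M \<in> invariant_msets Y f n. k \<le> count M x}"
      proof safe
        fix M assume M: "M \<in> invariant_msets Y f (n - k * least_power f x)"
        then show "M + repeat_mset k Q \<in> invariant_msets Y f n"
          using True Q_inv Q_sub' size_Q
          by (auto simp: invariant_msets_def multisets_of_size_def)
        from sub_iff[OF this] show "k \<le> count (M + repeat_mset k Q) x" by simp
      qed
    next
      show "(\<lambda>M. M - repeat_mset k Q) ` {M \<in> invariant_msets Y f n. k \<le> count M x}
          \<subseteq> invariant_msets Y f (n - k * least_power f x)"
      proof safe
        fix M assume M: "M \<in> invariant_msets Y f n" "k \<le> count M x"
        with sub_iff have sub: "repeat_mset k Q \<subseteq># M" by blast
        have "size (M - repeat_mset k Q) = n - k * least_power f x"
          using M size_Q by (simp add: size_Diff_submset[OF sub] invariant_msets_def multisets_of_size_def)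
        moreover have "image_mset f (M - repeat_mset k Q) = M - repeat_mset k Q"
          using M Q_inv by (simp add: image_mset_Diff[OF sub] invariant_msets_def)
        moreover have "set_mset (M - repeat_mset k Q) \<subseteq> Y"
          using M by (auto simp: invariant_msets_def multisets_of_size_def dest: in_diffD)
        ultimately show "M - repeat_mset k Q \<in> invariant_msets Y f (n - k * least_power f x)"
          by (simp add: invariant_msets_def multisets_of_size_def)
      qed
    qed (use sub_iff in auto)
    then show ?thesis using True by (simp add: bij_betw_same_card)
  next
    case False
    have "{M \<in> invariant_msets Y f n. k \<le> count M x} = {}"
    proof safe
      fix M assume M: "M \<in> invariant_msets Y f n" "k \<le> count M x"
      then have "size (repeat_mset k Q) \<le> size M"
        using sub_iff size_mset_mono by blast
      then show "M \<in> {}" using False M size_Q by (simp add: invariant_msets_def multisets_of_size_def)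
    qed
    then show ?thesis using False by (simp only: if_False card.empty)
  qed
qed

text \<open>Double counting of all elements of all invariant multisets. By size there are
  \<open>n\<close> in each; by layers one counts the triples of a multiset, a point \<open>x\<close>
  and a \<open>k\<close> not exceeding the multiplicity of \<open>x\<close>. If \<open>r\<close> is
  the orbit length of \<open>x\<close>, removing \<open>k\<close> copies of the orbit lowers the
  size by \<open>j = k * r\<close>, and \<open>r\<close> divides \<open>j\<close> exactly when
  \<open>f ^^ j\<close> fixes \<open>x\<close>.\<close>

lemma invariant_msets_recurrence:
  assumes "finite Y" "f permutes Y"
  shows "n * card (invariant_msets Y f n) =
    (\<Sum>j=1..n. card {x \<in> Y. (f ^^ j) x = x} * card (invariant_msets Y f (n - j)))"
proof -
  define I where "I = invariant_msets Y f"
  have perm: "permutation f" using assms by (auto simp: permutation_permutes)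
  have finI: "finite (I n)" using assms(1) by (simp add: I_def finite_invariant_msets)
  have "n * card (I n) = (\<Sum>M\<in>I n. size M)"
    by (simp add: I_def invariant_msets_def multisets_of_size_def)
  also have "\<dots> = (\<Sum>M\<in>I n. \<Sum>x\<in>Y. count M x)"
  proof (rule sum.cong)
    fix M assume "M \<in> I n"
    then have "set_mset M \<subseteq> Y" by (simp add: I_def invariant_msets_def multisets_of_size_def)
    then show "size M = (\<Sum>x\<in>Y. count M x)"
      unfolding size_multiset_overloaded_eq
      by (intro sum.mono_neutral_left) (auto simp: assms(1) not_in_iff)
  qed simp
  \<comment> \<open>Each multiplicity is written as the number of its layers \<open>k\<close>; the
    range up to \<open>n\<close> suffices because no multiplicity exceeds the size.\<close>
  also have "\<dots> = (\<Sum>M\<in>I n. \<Sum>x\<in>Y. \<Sum>k=1..n. if k \<le> count M x then 1 else 0)"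
  proof (intro sum.cong refl)
    fix M x assume "M \<in> I n"
    then have "count M x \<le> n"
      using count_le_size[of M x] by (simp add: I_def invariant_msets_def multisets_of_size_def)
    then have "{k \<in> {1..n}. k \<le> count M x} = {1..count M x}" by auto
    then show "count M x = (\<Sum>k=1..n. if k \<le> count M x then 1 else 0)"
      by (simp flip: sum.inter_filter)
  qed
  also have "\<dots> = (\<Sum>x\<in>Y. \<Sum>k=1..n. \<Sum>M\<in>I n. if k \<le> count M x then 1 else 0)"
    by (subst sum.swap) (intro sum.cong refl sum.swap)
  also have "\<dots> = (\<Sum>x\<in>Y. \<Sum>k=1..n. card {M \<in> I n. k \<le> count M x})"
    using finI by (simp flip: sum.inter_filter)
  also have "\<dots> = (\<Sum>x\<in>Y. \<Sum>j=1..n. if (f ^^ j) x = x then card (I (n - j)) else 0)"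
  proof (rule sum.cong)
    fix x assume x: "x \<in> Y"
    define r where "r = least_power f x"
    have r: "r > 0" using least_power_of_permutation[OF perm] by (simp add: r_def)
    have "(\<Sum>k=1..n. card {M \<in> I n. k \<le> count M x}) =
          (\<Sum>k=1..n. if k * r \<le> n then card (I (n - k * r)) else 0)"
      using card_invariant_msets_count_ge[OF assms x] by (intro sum.cong) (auto simp: I_def r_def)
    also have "\<dots> = (\<Sum>k\<in>{k\<in>{1..n}. k * r \<le> n}. card (I (n - k * r)))"
      by (simp only: sum.inter_filter[OF finite_atLeastAtMost])
    \<comment> \<open>Substitution \<open>j = k * r\<close>: the new index is the number of elements
      removed.\<close>
    also have "\<dots> = (\<Sum>j\<in>{j\<in>{1..n}. r dvd j}. card (I (n - j)))"
    proof (rule sum.reindex_bij_witness[where i = "\<lambda>j. j div r" and j = "\<lambda>k. k * r"])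
      fix k assume "k \<in> {k\<in>{1..n}. k * r \<le> n}"
      then show "k * r \<in> {j\<in>{1..n}. r dvd j}" using r by auto
    next
      fix j assume j: "j \<in> {j\<in>{1..n}. r dvd j}"
      then obtain q where "j = q * r" by (auto elim: dvdE simp: mult.commute)
      moreover then have "q \<le> n" "q > 0"
        using r j le_trans[of q "q * r" n] by auto
      ultimately show "j div r \<in> {k\<in>{1..n}. k * r \<le> n}" using r j by auto
    qed (use r in auto)
    also have "\<dots> = (\<Sum>j=1..n. if r dvd j then card (I (n - j)) else 0)"
      by (simp only: sum.inter_filter[OF finite_atLeastAtMost])
    finally show "(\<Sum>k=1..n. card {M \<in> I n. k \<le> count M x}) =
        (\<Sum>j=1..n. if (f ^^ j) x = x then card (I (n - j)) else 0)"
      unfolding r_def least_power_dvd[OF perm] .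
  qed simp
  also have "\<dots> = (\<Sum>j=1..n. \<Sum>x\<in>Y. if (f ^^ j) x = x then card (I (n - j)) else 0)"
    by (rule sum.swap)
  also have "\<dots> = (\<Sum>j=1..n. card {x \<in> Y. (f ^^ j) x = x} * card (I (n - j)))"
    using assms(1) by (simp flip: sum.inter_filter)
  finally show ?thesis by (simp add: I_def)
qed

section \<open>The cycle index and its recurrence\<close>

text \<open>The length \<open>N\<close> of the tuples is kept fixed, so that the recurrence in \<open>n\<close> does not change the
  extensional index set.\<close>

definition partitions_within :: "nat \<Rightarrow> nat \<Rightarrow> (nat \<Rightarrow> nat) set" where
  "partitions_within N n = {l \<in> {1..N} \<rightarrow>\<^sub>E UNIV. (\<Sum>i=1..N. i * l i) = n}"

definition cycle_weight :: "nat \<Rightarrow> (nat \<Rightarrow> real) \<Rightarrow> (nat \<Rightarrow> nat) \<Rightarrow> real" where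
  "cycle_weight N c l = (\<Prod>i=1..N. c i ^ l i / (fact (l i) * real i ^ l i))"

text \<open>This is the coefficient of x^n in exp(sum of c_i x^i / i for 1 \<le> i \<le> N). For
  \<open>n \<le> N\<close> it is the cycle index of the symmetric group on \<open>n\<close> letters,
  evaluated at \<open>c\<close>.\<close>

definition cycle_index :: "nat \<Rightarrow> (nat \<Rightarrow> real) \<Rightarrow> nat \<Rightarrow> real" where
  "cycle_index N c n = (\<Sum>l\<in>partitions_within N n. cycle_weight N c l)"

lemma finite_partitions_within: "finite (partitions_within N n)"
proof (rule finite_subset)
  show "partitions_within N n \<subseteq> {1..N} \<rightarrow>\<^sub>E {..n}"
  proof
    fix l assume l: "l \<in> partitions_within N n"
    have "l i \<le> n" if "i \<in> {1..N}" for i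
    proof -
      have "l i \<le> i * l i" using that by simp
      also have "\<dots> \<le> (\<Sum>i=1..N. i * l i)" by (rule member_le_sum) (use that in auto)
      finally show ?thesis using l by (simp add: partitions_within_def)
    qed
    then show "l \<in> {1..N} \<rightarrow>\<^sub>E {..n}"
      using l by (auto simp: partitions_within_def PiE_iff)
  qed
qed (auto intro: finite_PiE)

lemma cycle_index_0: "cycle_index N c 0 = 1"
proof -
  have "partitions_within N 0 = {\<lambda>i\<in>{1..N}. 0}"
    by (fastforce simp: partitions_within_def PiE_iff extensional_def)
  then show ?thesis by (simp add: cycle_index_def cycle_weight_def)
qed

text \<open>Only the factor of index \<open>j\<close> changes: it gains one \<open>c j\<close> in
  the numerator, and \<open>Suc (l j)\<close> from the factorial and \<open>j\<close> from the power
  in the denominator.\<close>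

lemma cycle_weight_increment:
  assumes "j \<in> {1..N}"
  shows "real (j * Suc (l j)) * cycle_weight N c (l(j := Suc (l j))) = c j * cycle_weight N c l"
proof -
  define R where "R = (\<Prod>i\<in>{1..N} - {j}. c i ^ l i / (fact (l i) * real i ^ l i))"
  have "cycle_weight N c (l(j := Suc (l j))) =
      c j ^ Suc (l j) / (fact (Suc (l j)) * real j ^ Suc (l j)) * R"
  proof -
    have "R = (\<Prod>i\<in>{1..N} - {j}. c i ^ (l(j := Suc (l j))) i /
        (fact ((l(j := Suc (l j))) i) * real i ^ (l(j := Suc (l j))) i))"
      unfolding R_def by (intro prod.cong) auto
    then show ?thesis
      unfolding cycle_weight_def using assms by (subst prod.remove[of _ j]) auto
  qed
  moreover have "cycle_weight N c l = c j ^ l j / (fact (l j) * real j ^ l j) * R"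
    unfolding cycle_weight_def R_def using assms by (subst prod.remove[of _ j]) auto
  moreover have "real j \<noteq> 0" "real (Suc (l j)) \<noteq> 0" using assms by simp_all
  \<comment> \<open>The cancellation of \<open>j\<close> and \<open>Suc (l j)\<close>, isolated as
    an identity in real variables \<open>x\<close> and \<open>s\<close>.\<close>
  moreover have "x * s * (y * u / (s * v * (x * w)) * R) = y * (u / (v * w) * R)"
    if "x \<noteq> 0" "s \<noteq> 0" for x s y u v w :: real
    using that by simp
  ultimately show ?thesis
    by (simp only: fact_Suc of_nat_mult power_Suc)
qed

text \<open>Comparing coefficients in x H' = (sum of c_j x^j) H for the exponential generating
  series H gives this identity. The proof is direct: \<open>n\<close> is distributed as the sum of
  \<open>j * l j\<close>, and lowering \<open>l j\<close> by one maps the tuples for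
  \<open>n\<close> with \<open>l j > 0\<close> bijectively to the tuples for \<open>n - j\<close>.
  The bound on \<open>n\<close> ensures that every \<open>j \<le> n\<close> is an index of the
  tuples.\<close>

lemma cycle_index_recurrence:
  assumes "n \<le> N"
  shows "real n * cycle_index N c n = (\<Sum>j=1..n. c j * cycle_index N c (n - j))"
proof -
  have part: "(\<Sum>l\<in>partitions_within N n. real (j * l j) * cycle_weight N c l) =
      (if j \<le> n then c j * cycle_index N c (n - j) else 0)" if j: "j \<in> {1..N}" for j
  proof -
    \<comment> \<open>Stated with the old and new terms added on opposite sides, so that it serves
      both for raising and for lowering \<open>l j\<close> without subtraction.\<close>
    have sum_upd: "(\<Sum>i=1..N. i * (l(j := v)) i) + j * l j = (\<Sum>i=1..N. i * l i) + j * v" for l :: "nat \<Rightarrow> nat" and v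
    proof -
      have "(\<Sum>i\<in>{1..N} - {j}. i * (l(j := v)) i) = (\<Sum>i\<in>{1..N} - {j}. i * l i)"
        by (intro sum.cong) auto
      then show ?thesis
        unfolding sum.remove[OF finite_atLeastAtMost j] by simp
    qed
    have "(\<Sum>l\<in>partitions_within N n. real (j * l j) * cycle_weight N c l) =
        (\<Sum>l\<in>{l\<in>partitions_within N n. l j > 0}. real (j * l j) * cycle_weight N c l)"
      by (rule sum.mono_neutral_right) (auto simp: finite_partitions_within)
    also have "\<dots> = (if j \<le> n then c j * cycle_index N c (n - j) else 0)"
    proof (cases "j \<le> n")
      case True
      have "(\<Sum>l\<in>{l\<in>partitions_within N n. l j > 0}. real (j * l j) * cycle_weight N c l) =
          (\<Sum>l\<in>partitions_within N (n - j). c j * cycle_weight N c l)"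
      proof (rule sum.reindex_bij_witness[where i = "\<lambda>l. l(j := Suc (l j))" and j = "\<lambda>l. l(j := l j - 1)"])
        fix l assume l: "l \<in> {l\<in>partitions_within N n. l j > 0}"
        then show "l(j := l j - 1, j := Suc ((l(j := l j - 1)) j)) = l" by auto
        have "j * (l j - 1) + j = j * l j" using l by (cases "l j") auto
        then show "l(j := l j - 1) \<in> partitions_within N (n - j)"
          using l j True sum_upd[of l "l j - 1"]
          by (auto simp: partitions_within_def PiE_iff extensional_def)
        show "c j * cycle_weight N c (l(j := l j - 1)) = real (j * l j) * cycle_weight N c l"
          using cycle_weight_increment[OF j, of "l(j := l j - 1)" c] l
          by (simp add: Suc_diff_1 del: of_nat_mult of_nat_Suc of_nat_diff mult_Suc_right)
      next
        fix l assume l: "l \<in> partitions_within N (n - j)"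
        then show "l(j := Suc (l j), j := (l(j := Suc (l j))) j - 1) = l" by simp
        show "l(j := Suc (l j)) \<in> {l\<in>partitions_within N n. l j > 0}"
          using l j True sum_upd[of l "Suc (l j)"]
          by (auto simp: partitions_within_def PiE_iff extensional_def)
      qed
      then show ?thesis using True by (simp add: cycle_index_def sum_distrib_left)
    next
      case False
      have "{l\<in>partitions_within N n. l j > 0} = {}"
      proof safe
        fix l assume l: "l \<in> partitions_within N n" "l j > 0"
        have "j * l j \<le> (\<Sum>i=1..N. i * l i)" by (rule member_le_sum) (use j in auto)
        moreover have "j \<le> j * l j" using l by (cases "l j") auto
        ultimately have "j \<le> (\<Sum>i=1..N. i * l i)" by (rule le_trans[rotated])
        then have "j \<le> n" using l by (simp add: partitions_within_def)
        with False show "l \<in> {}" by simp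
      qed
      then show ?thesis using False by (simp only: if_False sum.empty)
    qed
    finally show ?thesis .
  qed
  have "real n * cycle_index N c n =
      (\<Sum>l\<in>partitions_within N n. \<Sum>j=1..N. real (j * l j) * cycle_weight N c l)"
    unfolding cycle_index_def sum_distrib_left
    by (intro sum.cong refl) (simp add: partitions_within_def flip: sum_distrib_right of_nat_sum of_nat_mult)
  also have "\<dots> = (\<Sum>j=1..N. \<Sum>l\<in>partitions_within N n. real (j * l j) * cycle_weight N c l)"
    by (rule sum.swap)
  also have "\<dots> = (\<Sum>j=1..N. if j \<le> n then c j * cycle_index N c (n - j) else 0)"
    by (intro sum.cong refl part)
  also have "\<dots> = (\<Sum>j\<in>{j\<in>{1..N}. j \<le> n}. c j * cycle_index N c (n - j))"
    by (simp only: sum.inter_filter[OF finite_atLeastAtMost])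
  also have "{j\<in>{1..N}. j \<le> n} = {1..n}" using assms by auto
  finally show ?thesis .
qed

text \<open>Both sides are 1 at \<open>n = 0\<close> and obey the same recurrence, which for
  \<open>n > 0\<close> determines the value at \<open>n\<close> from the earlier ones.\<close>

lemma card_invariant_msets_eq_cycle_index:
  assumes "finite Y" "f permutes Y" "n \<le> N"
  shows "real (card (invariant_msets Y f n)) = cycle_index N (\<lambda>j. card {x \<in> Y. (f ^^ j) x = x}) n"
  using assms(3)
proof (induction n rule: less_induct)
  case (less n)
  show ?case
  proof (cases "n = 0")
    case True
    then show ?thesis by (simp add: cycle_index_0)
  next
    case False
    let ?c = "\<lambda>j. real (card {x \<in> Y. (f ^^ j) x = x})"
    have "real n * real (card (invariant_msets Y f n)) =
        (\<Sum>j=1..n. ?c j * real (card (invariant_msets Y f (n - j))))"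
      using arg_cong[OF invariant_msets_recurrence[OF assms(1,2), of n], of real] by simp
    also have "\<dots> = (\<Sum>j=1..n. ?c j * cycle_index N ?c (n - j))"
      using less by (intro sum.cong refl) simp
    also have "\<dots> = real n * cycle_index N ?c n"
      using cycle_index_recurrence[OF less.prems] by simp
    finally show ?thesis using False by simp
  qed
qed

lemma partitions_within_self: "partitions_within n n = cycle_types n"
  by (simp add: partitions_within_def cycle_types_def)

lemma cycle_weight_z_cycle:
  "cycle_weight n c l = (\<Prod>i=1..n. c i ^ l i) / real (z_cycle n l)"
  by (simp add: cycle_weight_def z_cycle_def prod_dividef prod.distrib of_nat_prod)

lemma card_invariant_msets:
  assumes "finite Y" "f permutes Y"
  shows "real (card (invariant_msets Y f n)) =
    (\<Sum>l\<in>cycle_types n. (\<Prod>j=1..n. real (card {x \<in> Y. (f ^^ j) x = x}) ^ l j) / real (z_cycle n l))"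
  using card_invariant_msets_eq_cycle_index[OF assms order_refl]
  by (simp add: cycle_index_def partitions_within_self cycle_weight_z_cycle)

text \<open>The identity on a one-point set has all fixed point counts equal to 1 and exactly one
  multiset of each size. This yields the constants 1 in the second form of the odd case.\<close>

lemma sum_inverse_z_cycle: "(\<Sum>l\<in>cycle_types n. 1 / real (z_cycle n l)) = 1"
proof -
  have "invariant_msets {()} id n = {replicate_mset n ()}"
    by (auto simp: invariant_msets_def multisets_of_size_def set_mset_subset_singletonD)
  then show ?thesis
    using card_invariant_msets[of "{()}" id n] by simp
qed

section \<open>The action of the units modulo m\<close>

text \<open>\<open>r\<close> is the pullback of \<open>s\<close> along the surjection
  \<open>f\<close>, so each class of \<open>r\<close> is the full preimage of a class of
  \<open>s\<close>. Injectivity of \<open>f\<close> is not asked for, since the map from element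
  systems to multisets forgets the order of the indices.\<close>

lemma card_quotient_reindex:
  assumes "f ` A = B"
    and "\<And>x y. x \<in> A \<Longrightarrow> y \<in> A \<Longrightarrow> (x, y) \<in> r \<longleftrightarrow> (f x, f y) \<in> s"
    and "r \<subseteq> A \<times> A" "s \<subseteq> B \<times> B"
  shows "card (A // r) = card (B // s)"
proof -
  have img: "f ` (r `` {x}) = s `` {f x}" if "x \<in> A" for x
    using assms that by (fastforce simp: image_iff)
  have pre: "r `` {x} = {y \<in> A. f y \<in> s `` {f x}}" if "x \<in> A" for x
    using assms that by auto
  have "bij_betw (\<lambda>P. f ` P) (A // r) (B // s)"
    unfolding bij_betw_def
  proof
    show "inj_on (\<lambda>P. f ` P) (A // r)"
    proof (rule inj_onI)
      fix P Y assume "P \<in> A // r" "Y \<in> A // r" and eq: "f ` P = f ` Y"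
      then obtain x y where "x \<in> A" "P = r `` {x}" "y \<in> A" "Y = r `` {y}"
        by (auto elim!: quotientE)
      then show "P = Y" using eq img pre by metis
    qed
    show "(\<lambda>P. f ` P) ` (A // r) = B // s"
      using img assms(1) by (auto simp: quotient_def image_iff) 
  qed
  then show ?thesis by (rule bij_betw_same_card)
qed

text \<open>The action of the inverse element supplies the inverse map. The restriction to
  \<open>E\<close> is needed because \<open>Bij E\<close> consists of extensional functions.\<close>

lemma (in group) group_action_restrict:
  assumes "\<And>g x. g \<in> carrier G \<Longrightarrow> x \<in> E \<Longrightarrow> f g x \<in> E"
    and "\<And>x. x \<in> E \<Longrightarrow> f \<one> x = x"
    and "\<And>g h x. g \<in> carrier G \<Longrightarrow> h \<in> carrier G \<Longrightarrow> x \<in> E \<Longrightarrow> f (g \<otimes> h) x = f g (f h x)"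
  shows "group_action G E (\<lambda>g. restrict (f g) E)"
proof -
  have bij: "restrict (f g) E \<in> Bij E" if g: "g \<in> carrier G" for g
  proof -
    have "bij_betw (f g) E E"
    proof (rule bij_betw_byWitness[where f' = "f (inv g)"])
      show "\<forall>x\<in>E. f (inv g) (f g x) = x" "\<forall>x\<in>E. f g (f (inv g) x) = x"
        using assms(3)[of "inv g" g] assms(3)[of g "inv g"] assms(2) g by auto
    qed (use assms(1) g in auto)
    then show ?thesis by (simp add: Bij_def)
  qed
  have "(\<lambda>g. restrict (f g) E) \<in> hom G (BijGroup E)"
  proof (rule homI)
    fix g h assume gh: "g \<in> carrier G" "h \<in> carrier G"
    show "restrict (f (g \<otimes> h)) E = restrict (f g) E \<otimes>\<^bsub>BijGroup E\<^esub> restrict (f h) E"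
      using gh bij assms(1,3) by (auto simp: BijGroup_def compose_def fun_eq_iff)
  qed (use bij in \<open>simp add: BijGroup_def\<close>)
  then show ?thesis
    by (simp add: group_action_def group_hom_def group_hom_axioms_def group_BijGroup is_group)
qed

definition unit_group :: "nat \<Rightarrow> nat monoid" where
  "unit_group m = \<lparr>carrier = totatives m, monoid.mult = (\<lambda>a b. a * b mod m), one = 1\<rparr>"

text \<open>For a unit \<open>a\<close> and \<open>m > 1\<close> this power inverts \<open>a\<close>
  by Euler's theorem; being a power, it is visibly multiplicative in \<open>a\<close>.\<close>

definition unit_inverse :: "nat \<Rightarrow> nat \<Rightarrow> nat" where
  "unit_inverse m a = a ^ (totient m - 1) mod m"

lemma mult_mod_in_totatives:
  assumes "m > 1" "a \<in> totatives m" "b \<in> totatives m"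
  shows "a * b mod m \<in> totatives m"
proof -
  have "coprime (a * b mod m) m" using assms by (simp add: in_totatives_iff)
  moreover have "a * b mod m \<noteq> 0"
    using calculation assms(1) by (intro notI) simp
  ultimately show ?thesis using assms(1) by (simp add: in_totatives_iff less_imp_le)
qed

lemma power_mod_in_totatives:
  assumes "m > 1" "a \<in> totatives m"
  shows "a ^ k mod m \<in> totatives m"
  using power_in_totatives[of m a k] assms by (auto simp: in_totatives_iff coprime_commute)

lemma unit_inverse_in_totatives:
  "m > 1 \<Longrightarrow> a \<in> totatives m \<Longrightarrow> unit_inverse m a \<in> totatives m"
  unfolding unit_inverse_def by (rule power_mod_in_totatives)

lemma mult_unit_inverse:
  assumes "m > 1" "a \<in> totatives m"
  shows "a * unit_inverse m a mod m = 1"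
proof -
  have "a * unit_inverse m a mod m = a * a ^ (totient m - 1) mod m"
    by (simp add: unit_inverse_def mod_mult_right_eq)
  also have "a * a ^ (totient m - 1) = a ^ totient m"
    using assms(1) by (simp add: power_eq_if)
  also have "a ^ totient m mod m = 1"
    using euler_theorem[of a m] assms by (simp add: in_totatives_iff cong_def)
  finally show ?thesis .
qed

lemma group_unit_group:
  assumes "m > 1"
  shows "group (unit_group m)"
proof (rule groupI)
  fix a assume "a \<in> carrier (unit_group m)"
  then have "unit_inverse m a \<in> carrier (unit_group m)" "unit_inverse m a \<otimes>\<^bsub>unit_group m\<^esub> a = \<one>\<^bsub>unit_group m\<^esub>"
    using unit_inverse_in_totatives mult_unit_inverse assms by (auto simp: unit_group_def mult.commute)
  then show "\<exists>y\<in>carrier (unit_group m). y \<otimes>\<^bsub>unit_group m\<^esub> a = \<one>\<^bsub>unit_group m\<^esub>" by blast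
qed (use assms mult_mod_in_totatives in \<open>auto simp: unit_group_def mod_mult_left_eq mod_mult_right_eq mult.assoc totatives_less\<close>)

text \<open>Points outside the square of residues stay fixed, so that a unit gives a permutation of
  the whole type, as \<open>permutes\<close> demands.\<close>

definition unit_act :: "nat \<Rightarrow> nat \<Rightarrow> nat \<times> nat \<Rightarrow> nat \<times> nat" where
  "unit_act m a = (\<lambda>(i, j). if i < m \<and> j < m then (a * i mod m, unit_inverse m a * j mod m) else (i, j))"

lemma unit_inverse_mult: "unit_inverse m (a * b mod m) = unit_inverse m a * unit_inverse m b mod m"
  by (simp add: unit_inverse_def power_mod power_mult_distrib mod_mult_eq)

lemma unit_act_mult: "unit_act m (a * b mod m) x = unit_act m a (unit_act m b x)"
proof (cases "m = 0")
  case False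
  then show ?thesis
    by (auto simp: unit_act_def unit_inverse_mult mod_mult_left_eq mod_mult_right_eq mult.assoc split: prod.split)
qed (simp add: unit_act_def split: prod.split)

lemma unit_act_1: "m > 1 \<Longrightarrow> unit_act m 1 x = x"
  by (auto simp: unit_act_def unit_inverse_def split: prod.split)

lemma unit_act_funpow:
  assumes "m > 1"
  shows "(unit_act m a ^^ k) x = unit_act m (a ^ k mod m) x"
proof (induction k)
  case 0
  then show ?case using unit_act_1[OF assms] assms by simp
next
  case (Suc k)
  have "a ^ Suc k mod m = a * (a ^ k mod m) mod m" by (simp add: mod_mult_right_eq)
  then show ?case by (simp only: unit_act_mult funpow.simps o_apply Suc)
qed

lemma unit_act_permutes:
  assumes "m > 1" "a \<in> totatives m"
  shows "unit_act m a permutes {..<m} \<times> {..<m}"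
proof -
  have "unit_act m a (unit_act m (unit_inverse m a) x) = x"
       "unit_act m (unit_inverse m a) (unit_act m a x) = x" for x
    using mult_unit_inverse[OF assms] unit_act_1[OF assms(1)]
    by (simp_all add: mult.commute flip: unit_act_mult)
  then have "bij (unit_act m a)" by (intro o_bij[of "unit_act m (unit_inverse m a)"]) auto
  moreover have "unit_act m a x = x" if "x \<notin> {..<m} \<times> {..<m}" for x
    using that by (auto simp: unit_act_def split: prod.split)
  ultimately show ?thesis by (auto simp: permutes_def bij_iff)
qed

section \<open>Fixed points of a unit on pairs of residues\<close>

text \<open>With \<open>g = gcd c m\<close> and \<open>m = q * g\<close>, the quotient of
  \<open>c\<close> by \<open>g\<close> is coprime to \<open>q\<close>, so the condition says that
  \<open>q\<close> divides \<open>i\<close>; there are \<open>g\<close> multiples of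
  \<open>q\<close> below \<open>m\<close>.\<close>

lemma card_mult_dvd:
  fixes m c :: nat
  assumes "m > 0"
  shows "card {i. i < m \<and> m dvd c * i} = gcd c m"
proof -
  define g q where "g = gcd c m" and "q = m div g"
  have g: "g > 0" "m = q * g" using assms by (auto simp: g_def q_def)
  then have q: "q > 0" using assms by (cases q) auto
  have c: "c = (c div g) * g" by (simp add: g_def)
  have cop: "coprime (c div g) q"
    unfolding g_def q_def by (rule div_gcd_coprime) (use assms in auto)
  have "m dvd c * i \<longleftrightarrow> q dvd i" for i
  proof -
    have "m dvd c * i \<longleftrightarrow> q * g dvd (c div g) * i * g"
      using c g(2) by (metis mult.assoc mult.commute)
    also have "\<dots> \<longleftrightarrow> q dvd (c div g) * i" using g(1) by simp
    also have "\<dots> \<longleftrightarrow> q dvd i"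
      using cop by (simp add: coprime_dvd_mult_right_iff coprime_commute)
    finally show ?thesis .
  qed
  then have "{i. i < m \<and> m dvd c * i} = (\<lambda>k. q * k) ` {..<g}"
    using g q by (auto elim!: dvdE)
  then show ?thesis
    using q by (simp add: card_image inj_on_def g_def)
qed

lemma card_fixed_unit_mult:
  fixes m b :: nat
  assumes "m > 1" "b > 0"
  shows "card {i. i < m \<and> b * i mod m = i} = gcd (b - 1) m"
proof -
  have "b * i mod m = i \<longleftrightarrow> m dvd (b - 1) * i" if "i < m" for i
  proof -
    have "b * i mod m = i \<longleftrightarrow> [b * i = i] (mod m)" using that by (simp add: cong_def)
    also have "\<dots> \<longleftrightarrow> m dvd b * i - i" using assms(2) by (simp add: cong_altdef_nat)
    also have "b * i - i = (b - 1) * i" by (simp add: diff_mult_distrib)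
    finally show ?thesis .
  qed
  then have "{i. i < m \<and> b * i mod m = i} = {i. i < m \<and> m dvd (b - 1) * i}" by auto
  then show ?thesis using card_mult_dvd[of m "b - 1"] assms(1) by simp
qed

lemma unit_inverse_fixes_iff:
  assumes "m > 1" "a \<in> totatives m" "i < m"
  shows "unit_inverse m a * i mod m = i \<longleftrightarrow> a * i mod m = i"
proof -
  have "a * (unit_inverse m a * i) mod m = i"
    using mult_unit_inverse[OF assms(1,2)] assms(3)
    by (metis mod_mult_left_eq mult.assoc mult_1 mod_less)
  then show ?thesis
    using mult_unit_inverse[OF assms(1,2)] assms(3)
    by (metis mod_mult_right_eq mult.left_commute)
qed

text \<open>A residue is fixed by a unit exactly when it is fixed by the inverse unit. Hence both
  coordinates range over the same set, whose size is the gcd, and the square appears.\<close>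

lemma card_fixed_unit_act:
  assumes "m > 1" "a \<in> totatives m"
  shows "card {x \<in> {..<m} \<times> {..<m}. (unit_act m a ^^ k) x = x} = (gcd (a ^ k - 1) m)\<^sup>2"
proof -
  define b where "b = a ^ k mod m"
  have b: "b \<in> totatives m" unfolding b_def by (rule power_mod_in_totatives[OF assms])
  define S where "S = {i. i < m \<and> b * i mod m = i}"
  have "(unit_act m a ^^ k) x = unit_act m b x" for x
    by (simp add: unit_act_funpow[OF assms(1)] b_def)
  then have "{x \<in> {..<m} \<times> {..<m}. (unit_act m a ^^ k) x = x} = S \<times> S"
    using unit_inverse_fixes_iff[OF assms(1) b]
    by (auto simp: unit_act_def[of m b] S_def)
  moreover have "card S = gcd (a ^ k - 1) m"
  proof -
    have "S = {i. i < m \<and> a ^ k * i mod m = i}" by (simp add: S_def b_def mod_mult_left_eq)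
    moreover have "a ^ k > 0" using assms(2) by (simp add: in_totatives_iff)
    ultimately show ?thesis using card_fixed_unit_mult[OF assms(1)] by simp
  qed
  ultimately show ?thesis by (simp add: card_cartesian_product power2_eq_square)
qed

section \<open>Burnside's lemma for the units acting on multisets\<close>

definition unit_orbit_rel :: "nat \<Rightarrow> nat \<Rightarrow> ((nat \<times> nat) multiset \<times> (nat \<times> nat) multiset) set" where
  "unit_orbit_rel m n = {(M, M'). M \<in> multisets_of_size ({..<m} \<times> {..<m}) n
     \<and> M' \<in> multisets_of_size ({..<m} \<times> {..<m}) n
     \<and> (\<exists>a\<in>totatives m. M' = image_mset (unit_act m a) M)}"

text \<open>Burnside's lemma: the classes of the explicit relation are the orbits, and the
  invariants of a unit are the multisets that it fixes.\<close>

lemma card_unit_orbits: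
  assumes "m > 1"
  shows "card (multisets_of_size ({..<m} \<times> {..<m}) n // unit_orbit_rel m n) * totient m =
    (\<Sum>a\<in>totatives m. card (invariant_msets ({..<m} \<times> {..<m}) (unit_act m a) n))"
proof -
  define E where "E = multisets_of_size ({..<m} \<times> {..<m}) n"
  define \<phi> where "\<phi> = (\<lambda>a. restrict (image_mset (unit_act m a)) E)"
  have closed: "image_mset (unit_act m a) M \<in> E" if "a \<in> totatives m" "M \<in> E" for a M
  proof -
    have "unit_act m a ` set_mset M \<subseteq> unit_act m a ` ({..<m} \<times> {..<m})"
      using that(2) by (intro image_mono) (simp add: E_def multisets_of_size_def)
    then show ?thesis
      using that(2) permutes_image[OF unit_act_permutes[OF assms that(1)]]
      by (simp add: E_def multisets_of_size_def)
  qed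
  interpret U: group "unit_group m" by (rule group_unit_group[OF assms])
  interpret group_action "unit_group m" E \<phi>
    unfolding \<phi>_def
  proof (rule U.group_action_restrict)
    fix M assume "M \<in> E"
    show "image_mset (unit_act m \<one>\<^bsub>unit_group m\<^esub>) M = M"
      using unit_act_1[OF assms] by (simp add: unit_group_def cong: image_mset_cong)
  next
    fix a b M
    show "image_mset (unit_act m (a \<otimes>\<^bsub>unit_group m\<^esub> b)) M =
        image_mset (unit_act m a) (image_mset (unit_act m b) M)"
      by (simp add: unit_group_def unit_act_mult multiset.map_comp o_def cong: image_mset_cong)
  qed (use closed in \<open>simp add: unit_group_def\<close>)
  have "E // unit_orbit_rel m n = orbits (unit_group m) E \<phi>"
  proof -
    have "unit_orbit_rel m n `` {M} = orbit (unit_group m) \<phi> M" if "M \<in> E" for M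
      using that closed
      by (auto simp: unit_orbit_rel_def orbit_def \<phi>_def unit_group_def simp flip: E_def)
    then show ?thesis by (auto simp: quotient_def orbits_def)
  qed
  moreover have "invariants E \<phi> a = invariant_msets ({..<m} \<times> {..<m}) (unit_act m a) n" for a
    by (auto simp: invariants_def invariant_msets_def \<phi>_def E_def)
  moreover have "finite E" by (auto simp: E_def)
  moreover have "Coset.order (unit_group m) = totient m" "carrier (unit_group m) = totatives m"
    by (simp_all add: Coset.order_def unit_group_def totient_def)
  ultimately show ?thesis
    using burnside by (simp flip: E_def)
qed

lemma card_unit_orbits_formula:
  assumes "m > 1"
  shows "real (totient m) * real (card (multisets_of_size ({..<m} \<times> {..<m}) n // unit_orbit_rel m n)) =
    (\<Sum>a\<in>totatives m. \<Sum>l\<in>cycle_types n.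
       (\<Prod>j=1..n. real (gcd (a ^ j - 1) m) ^ (2 * l j)) / real (z_cycle n l))"
proof -
  have "real (totient m) * real (card (multisets_of_size ({..<m} \<times> {..<m}) n // unit_orbit_rel m n)) =
      (\<Sum>a\<in>totatives m. real (card (invariant_msets ({..<m} \<times> {..<m}) (unit_act m a) n)))"
    using arg_cong[OF card_unit_orbits[OF assms, of n], of real] by (simp add: mult.commute)
  also have "\<dots> = (\<Sum>a\<in>totatives m. \<Sum>l\<in>cycle_types n.
       (\<Prod>j=1..n. real (gcd (a ^ j - 1) m) ^ (2 * l j)) / real (z_cycle n l))"
    by (intro sum.cong refl, subst card_invariant_msets)
       (simp_all add: unit_act_permutes[OF assms] card_fixed_unit_act[OF assms] power_mult)
  finally show ?thesis .
qed

section \<open>Element systems over a cyclic group\<close>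

lemma (in group) nat_pow_eq_iff:
  assumes "x \<in> carrier G"
  shows "x [^] (i::nat) = x [^] (j::nat) \<longleftrightarrow> [i = j] (mod ord x)"
proof -
  have "x [^] i = x [^] j \<longleftrightarrow> x [^] int i = x [^] int j" by (simp add: int_pow_int)
  also have "\<dots> \<longleftrightarrow> [int j = int i] (mod int (ord x))"
    using assms by (simp add: int_pow_eq cong_iff_dvd_diff)
  finally show ?thesis by (simp add: cong_int_iff cong_sym_eq)
qed

lemma (in field) finite_roots_of_unity:
  assumes "m > 0"
  shows "finite {x \<in> carrier R. x [^] (m::nat) = \<one>}" "card {x \<in> carrier R. x [^] m = \<one>} \<le> m"
proof -
  \<comment> \<open>The coefficients of X^m - 1, leading coefficient first.\<close>
  define p where "p = \<one> # replicate (m - 1) \<zero> @ [\<ominus> \<one>]"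
  have "polynomial (carrier R) p" unfolding polynomial_def p_def by auto
  then have p: "p \<in> carrier (poly_ring R)" by (simp add: univ_poly_carrier)
  have eval: "eval p x = x [^] m \<oplus> \<ominus> \<one>" if "x \<in> carrier R" for x
    using that assms by (simp add: p_def eval_replicate)
  have sub: "{x \<in> carrier R. x [^] m = \<one>} \<subseteq> set_mset (roots p)"
  proof safe
    fix x assume "x \<in> carrier R" "x [^] m = \<one>"
    then have "is_root p x" using eval by (simp add: is_root_def p_def r_neg)
    then show "x \<in># roots p" using roots_mem_iff_is_root[OF p] by simp
  qed
  then show "finite {x \<in> carrier R. x [^] m = \<one>}" by (rule finite_subset) simp
  have "card {x \<in> carrier R. x [^] m = \<one>} \<le> card (set_mset (roots p))"
    using sub by (intro card_mono) auto
  also have "\<dots> \<le> size (roots p)"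
    using size_mset_mono[OF mset_set_set_mset_msubset, of "roots p"] by simp
  also have "\<dots> \<le> degree p" by (rule size_roots_le_degree[OF p])
  also have "degree p = m" using assms by (simp add: p_def)
  finally show "card {x \<in> carrier R. x [^] m = \<one>} \<le> m" .
qed

locale cyclic_with_root = group G + F: field F
  for G :: "('a, 'c) monoid_scheme" (structure) and F :: "('b, 'd) ring_scheme" +
  fixes m :: nat and g :: 'a and \<zeta> :: 'b
  assumes m_gt_1: "m > 1"
    and gen_closed [simp]: "g \<in> carrier G"
    and carrier_eq: "carrier G = (\<lambda>i::nat. g [^] i) ` {..<m}"
    and ord_gen: "ord g = m"
    and root: "primitive_root_of_one F m \<zeta>"
begin

lemma gen_pow_eq_iff: "g [^] (i::nat) = g [^] (j::nat) \<longleftrightarrow> [i = j] (mod m)"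
  using nat_pow_eq_iff[OF gen_closed] ord_gen by simp

text \<open>The name is qualified because \<open>Ring_Divisibility\<close> introduces a second constant \<open>mult_of\<close>.\<close>

lemma root_closed: "\<zeta> \<in> carrier (Multiplicative_Group.mult_of F)"
proof -
  have "\<zeta> \<noteq> \<zero>\<^bsub>F\<^esub>"
  proof
    assume "\<zeta> = \<zero>\<^bsub>F\<^esub>"
    then have "\<zeta> [^]\<^bsub>F\<^esub> m = \<zero>\<^bsub>F\<^esub>" using m_gt_1 by (simp add: F.nat_pow_zero)
    then show False using root by (simp add: primitive_root_of_one_def)
  qed
  then show ?thesis using root by (simp add: primitive_root_of_one_def)
qed

text \<open>The minimality in \<open>primitive_root_of_one\<close> makes the multiplicative order of
  \<zeta> exactly \<open>m\<close>.\<close>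

lemma root_pow_eq_iff: "\<zeta> [^]\<^bsub>F\<^esub> (i::nat) = \<zeta> [^]\<^bsub>F\<^esub> (j::nat) \<longleftrightarrow> [i = j] (mod m)"
proof -
  interpret M: group "Multiplicative_Group.mult_of F" by (rule F.field_mult_group)
  have dvd: "M.ord \<zeta> dvd m"
    using root root_closed by (simp add: primitive_root_of_one_def Multiplicative_Group.nat_pow_mult_of flip: M.pow_eq_id)
  have "\<zeta> [^]\<^bsub>F\<^esub> M.ord \<zeta> = \<one>\<^bsub>F\<^esub>"
    using M.pow_ord_eq_1[OF root_closed] by (simp add: Multiplicative_Group.nat_pow_mult_of)
  moreover have "M.ord \<zeta> > 0" using dvd m_gt_1 by (intro Nat.gr0I) auto
  ultimately have "\<not> M.ord \<zeta> < m" using root by (auto simp: primitive_root_of_one_def)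
  with dvd have "M.ord \<zeta> = m" using m_gt_1 by (auto dest: dvd_imp_le)
  then show ?thesis using M.nat_pow_eq_iff[OF root_closed, of i j] by (simp add: Multiplicative_Group.nat_pow_mult_of)
qed

lemma root_pow_closed [simp]: "\<zeta> [^]\<^bsub>F\<^esub> (i::nat) \<in> carrier F"
  using root by (simp add: primitive_root_of_one_def)

lemma root_pow_nonzero: "\<zeta> [^]\<^bsub>F\<^esub> (i::nat) \<noteq> \<zero>\<^bsub>F\<^esub>"
proof -
  interpret M: group "Multiplicative_Group.mult_of F" by (rule F.field_mult_group)
  show ?thesis using M.nat_pow_closed[OF root_closed, of i] by (simp add: Multiplicative_Group.nat_pow_mult_of)
qed

text \<open>The powers of \<zeta> are \<open>m\<close> distinct roots of X^m - 1, and a field has no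
  more than \<open>m\<close> of them.\<close>

lemma roots_of_unity_eq:
  "{x \<in> carrier F. x [^]\<^bsub>F\<^esub> m = \<one>\<^bsub>F\<^esub>} = (\<lambda>i. \<zeta> [^]\<^bsub>F\<^esub> i) ` {..<m}"
proof (rule sym, rule card_seteq)
  have *: "(\<zeta> [^]\<^bsub>F\<^esub> i) [^]\<^bsub>F\<^esub> m = \<one>\<^bsub>F\<^esub>" for i :: nat
  proof -
    have "\<zeta> [^]\<^bsub>F\<^esub> (i * m) = \<zeta> [^]\<^bsub>F\<^esub> (0::nat)" unfolding root_pow_eq_iff by (simp add: cong_def)
    then show ?thesis using root_closed by (simp add: F.nat_pow_pow)
  qed
  then show "(\<lambda>i. \<zeta> [^]\<^bsub>F\<^esub> i) ` {..<m} \<subseteq> {x \<in> carrier F. x [^]\<^bsub>F\<^esub> m = \<one>\<^bsub>F\<^esub>}" by auto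
  have "inj_on (\<lambda>i. \<zeta> [^]\<^bsub>F\<^esub> i) {..<m}"
    by (rule inj_onI) (simp add: root_pow_eq_iff cong_less_modulus_unique_nat)
  then show "card {x \<in> carrier F. x [^]\<^bsub>F\<^esub> m = \<one>\<^bsub>F\<^esub>} \<le> card ((\<lambda>i. \<zeta> [^]\<^bsub>F\<^esub> i) ` {..<m})"
    using F.finite_roots_of_unity(2)[of m] m_gt_1 by (simp add: card_image)
qed (use F.finite_roots_of_unity(1)[of m] m_gt_1 in simp)

section \<open>Characters and elements as exponents\<close>

definition dlog :: "'a \<Rightarrow> nat" where
  "dlog = inv_into {..<m} (\<lambda>i. g [^] i)"

lemma gen_pow_dlog: "x \<in> carrier G \<Longrightarrow> g [^] dlog x = x"
  unfolding dlog_def carrier_eq by (rule f_inv_into_f)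

lemma dlog_gen_pow: "[dlog (g [^] (i::nat)) = i] (mod m)"
  using gen_pow_dlog[of "g [^] i"] by (simp add: gen_pow_eq_iff)

text \<open>The character sending the generator to the \<open>j\<close>-th power of \<zeta>, made
  extensional as \<open>characters\<close> requires.\<close>

definition chi :: "nat \<Rightarrow> 'a \<Rightarrow> 'b" where
  "chi j = (\<lambda>x\<in>carrier G. \<zeta> [^]\<^bsub>F\<^esub> (j * dlog x))"

lemma chi_gen_pow: "chi j (g [^] (i::nat)) = \<zeta> [^]\<^bsub>F\<^esub> (j * i)"
  by (simp add: chi_def root_pow_eq_iff cong_scalar_left dlog_gen_pow)

lemma chi_in_characters: "chi j \<in> characters G F"
proof -
  have "chi j \<in> hom G (Multiplicative_Group.mult_of F)"
  proof (rule homI)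
    fix x y assume "x \<in> carrier G" "y \<in> carrier G"
    then obtain i k where ik: "x = g [^] (i::nat)" "y = g [^] (k::nat)" using carrier_eq by auto
    then have "x \<otimes> y = g [^] (i + k)" by (simp add: nat_pow_mult)
    then show "chi j (x \<otimes> y) = chi j x \<otimes>\<^bsub>Multiplicative_Group.mult_of F\<^esub> chi j y"
      using root_closed by (simp only: ik chi_gen_pow) (simp add: F.nat_pow_mult distrib_left)
  qed (simp add: chi_def root_pow_nonzero)
  then show ?thesis by (simp add: characters_def chi_def)
qed

text \<open>A character is determined by its value at \<open>g\<close>, which is an
  \<open>m\<close>-th root of unity and hence a power of \<zeta>.\<close>

lemma character_eq_chi:
  assumes "\<chi> \<in> characters G F"
  obtains j where "j < m" "\<chi> = chi j"
proof -
  interpret M: group "Multiplicative_Group.mult_of F" by (rule F.field_mult_group)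
  have hom: "\<chi> \<in> hom G (Multiplicative_Group.mult_of F)" and ext: "\<chi> \<in> extensional (carrier G)"
    using assms by (auto simp: characters_def)
  interpret H: group_hom G "Multiplicative_Group.mult_of F" \<chi>
    using hom by unfold_locales
  have pow: "\<chi> (g [^] (i::nat)) = \<chi> g [^]\<^bsub>F\<^esub> i" for i
    using H.hom_nat_pow[OF gen_closed, of i] by (simp add: Multiplicative_Group.nat_pow_mult_of)
  have "\<chi> g \<in> carrier F" using H.hom_closed[OF gen_closed] by simp
  moreover have "\<chi> g [^]\<^bsub>F\<^esub> m = \<one>\<^bsub>F\<^esub>"
  proof -
    have "g [^] m = \<one>" using ord_gen pow_ord_eq_1[OF gen_closed] by simp
    then show ?thesis using pow[of m] H.hom_one by simp
  qed
  ultimately obtain j where j: "j < m" "\<chi> g = \<zeta> [^]\<^bsub>F\<^esub> j" using roots_of_unity_eq by blast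
  have "\<chi> = chi j"
  proof (rule extensionalityI[OF ext])
    fix x assume "x \<in> carrier G"
    then obtain i where "x = g [^] (i::nat)" using carrier_eq by auto
    then show "\<chi> x = chi j x"
      using j root_closed by (simp only: pow chi_gen_pow) (simp add: F.nat_pow_pow)
  qed (simp add: chi_def)
  with j that show thesis by blast
qed

definition decode :: "nat \<times> nat \<Rightarrow> 'a \<times> ('a \<Rightarrow> 'b)" where
  "decode = (\<lambda>(i, j). (g [^] i, chi j))"

definition encode :: "'a \<times> ('a \<Rightarrow> 'b) \<Rightarrow> nat \<times> nat" where
  "encode = inv_into ({..<m} \<times> {..<m}) decode"

lemma bij_betw_decode: "bij_betw decode ({..<m} \<times> {..<m}) (carrier G \<times> characters G F)"
  unfolding bij_betw_def
proof
  show "inj_on decode ({..<m} \<times> {..<m})"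
  proof (rule inj_onI)
    fix P P' assume P: "P \<in> {..<m} \<times> {..<m}" "P' \<in> {..<m} \<times> {..<m}" "decode P = decode P'"
    obtain i j i' j' where eq: "P = (i, j)" "P' = (i', j')" by (cases P, cases P')
    with P have less: "i < m" "j < m" "i' < m" "j' < m" by auto
    from P eq have "g [^] i = g [^] i'" "chi j = chi j'" by (auto simp: decode_def)
    \<comment> \<open>Evaluation at the generator, the power with exponent 1, recovers
      \<open>j\<close> modulo \<open>m\<close>.\<close>
    moreover then have "\<zeta> [^]\<^bsub>F\<^esub> j = \<zeta> [^]\<^bsub>F\<^esub> j'"
      using chi_gen_pow[of j 1] chi_gen_pow[of j' 1] by simp
    ultimately show "P = P'"
      using less eq by (simp add: gen_pow_eq_iff root_pow_eq_iff cong_less_modulus_unique_nat)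
  qed
  show "decode ` ({..<m} \<times> {..<m}) = carrier G \<times> characters G F"
  proof
    show "decode ` ({..<m} \<times> {..<m}) \<subseteq> carrier G \<times> characters G F"
      by (auto simp: decode_def chi_in_characters)
    show "carrier G \<times> characters G F \<subseteq> decode ` ({..<m} \<times> {..<m})"
    proof clarify
      fix x \<chi> assume "x \<in> carrier G" "\<chi> \<in> characters G F"
      then obtain i j where "x = g [^] (i::nat)" "i < m" "j < m" "\<chi> = chi j"
        using carrier_eq by (auto elim: character_eq_chi)
      then show "(x, \<chi>) \<in> decode ` ({..<m} \<times> {..<m})"
        by (auto simp: decode_def image_iff)
    qed
  qed
qed

lemma encode_in: "Q \<in> carrier G \<times> characters G F \<Longrightarrow> encode Q \<in> {..<m} \<times> {..<m}"
  unfolding encode_def bij_betw_imp_surj_on[OF bij_betw_decode, symmetric] by (rule inv_into_into)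

lemma decode_encode: "Q \<in> carrier G \<times> characters G F \<Longrightarrow> decode (encode Q) = Q"
  unfolding encode_def bij_betw_imp_surj_on[OF bij_betw_decode, symmetric] by (rule f_inv_into_f)

lemma encode_decode: "Y \<in> {..<m} \<times> {..<m} \<Longrightarrow> encode (decode Y) = Y"
  unfolding encode_def by (rule inv_into_f_f[OF bij_betw_imp_inj_on[OF bij_betw_decode]])

section \<open>Automorphisms as units and their action on codes\<close>

text \<open>An automorphism is determined by the image of the generator, a power with exponent
  \<open>a\<close>. Surjectivity gives an \<open>i\<close> with \<open>a * i\<close> congruent to 1,
  so \<open>a\<close> is a unit.\<close>

lemma iso_gen_pow:
  assumes "\<phi> \<in> iso G G"
  obtains a where "a \<in> totatives m" "\<And>i::nat. \<phi> (g [^] i) = g [^] (a * i)"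
proof -
  interpret H: group_hom G G \<phi>
    using assms by unfold_locales (simp add: iso_def)
  obtain a where a: "a < m" "\<phi> g = g [^] (a::nat)"
    using H.hom_closed[OF gen_closed] carrier_eq by auto
  have pow: "\<phi> (g [^] i) = g [^] (a * i)" for i :: nat
    using H.hom_nat_pow[OF gen_closed, of i] a by (simp add: nat_pow_pow)
  have "g \<in> \<phi> ` carrier G" using assms by (simp add: iso_def bij_betw_def)
  then obtain x where x: "x \<in> carrier G" "\<phi> x = g" by blast
  define i where "i = dlog x"
  have "g [^] (a * i) = \<phi> (g [^] i)" by (rule pow[symmetric])
  also have "\<dots> = g" using x gen_pow_dlog unfolding i_def by (simp only:)
  also have "\<dots> = g [^] (1::nat)" by (simp add: nat_pow_eone)
  finally have "g [^] (a * i) = g [^] (1::nat)" .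
  then have "[a * i = 1] (mod m)" by (simp only: gen_pow_eq_iff)
  then have cop: "coprime a m" by (metis coprime_iff_invertible_nat One_nat_def)
  moreover have "a \<noteq> 0" using cop m_gt_1 by (intro notI) simp
  ultimately have "a \<in> totatives m" using a by (simp add: in_totatives_iff)
  with pow that show thesis by blast
qed

text \<open>Multiplying discrete logarithms by \<open>a\<close> is well defined modulo
  \<open>m\<close> and injective because \<open>a\<close> can be cancelled; finiteness turns this
  into bijectivity.\<close>

lemma ex_iso_gen_pow:
  assumes "a \<in> totatives m"
  obtains \<phi> where "\<phi> \<in> iso G G" "\<And>i::nat. \<phi> (g [^] i) = g [^] (a * i)"
proof -
  define \<phi> where "\<phi> = (\<lambda>x. g [^] (a * dlog x))"
  have pow: "\<phi> (g [^] i) = g [^] (a * i)" for i :: nat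
    by (simp add: \<phi>_def gen_pow_eq_iff cong_scalar_left dlog_gen_pow)
  have "\<phi> \<in> hom G G"
  proof (rule homI)
    fix x y assume "x \<in> carrier G" "y \<in> carrier G"
    then obtain i k where ik: "x = g [^] (i::nat)" "y = g [^] (k::nat)" using carrier_eq by auto
    then have "x \<otimes> y = g [^] (i + k)" by (simp add: nat_pow_mult)
    then show "\<phi> (x \<otimes> y) = \<phi> x \<otimes> \<phi> y"
      by (simp only: ik pow) (simp add: nat_pow_mult distrib_left)
  qed (simp add: \<phi>_def)
  moreover have "bij_betw \<phi> (carrier G) (carrier G)"
  proof -
    have "inj_on \<phi> (carrier G)"
    proof (rule inj_onI)
      fix x y assume "x \<in> carrier G" "y \<in> carrier G" and eq: "\<phi> x = \<phi> y"
      then obtain i k where ik: "x = g [^] (i::nat)" "y = g [^] (k::nat)" using carrier_eq by auto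
      with eq have "[a * i = a * k] (mod m)" by (simp add: pow gen_pow_eq_iff)
      then have "[i = k] (mod m)"
        using assms by (simp add: cong_mult_lcancel_nat in_totatives_iff)
      then show "x = y" by (simp add: ik gen_pow_eq_iff)
    qed
    moreover have "\<phi> ` carrier G \<subseteq> carrier G" by (auto simp: \<phi>_def)
    moreover have "finite (carrier G)" by (simp add: carrier_eq)
    ultimately show ?thesis by (simp add: bij_betw_def endo_inj_surj)
  qed
  ultimately show thesis using pow that by (auto simp: iso_def)
qed

text \<open>Comparing exponents of \<open>g\<close> gives \<open>a * i\<close> for the first
  coordinate. The two characters agree along \<phi> as soon as they do at the generator, where the
  condition is that \<open>j' * a\<close> is congruent to \<open>j\<close>; this puts the inverse of
  \<open>a\<close> on the second coordinate.\<close>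

lemma encode_action:
  assumes "Q \<in> carrier G \<times> characters G F" "Q' \<in> carrier G \<times> characters G F"
    and "a \<in> totatives m" and \<phi>: "\<And>i::nat. \<phi> (g [^] i) = g [^] (a * i)"
  shows "\<phi> (fst Q) = fst Q' \<and> (\<forall>x\<in>carrier G. snd Q' (\<phi> x) = snd Q x) \<longleftrightarrow>
    encode Q' = unit_act m a (encode Q)"
proof -
  obtain i j where ij: "encode Q = (i, j)" "i < m" "j < m" using encode_in[OF assms(1)] by auto
  obtain i' j' where ij': "encode Q' = (i', j')" "i' < m" "j' < m" using encode_in[OF assms(2)] by auto
  have Q: "Q = (g [^] i, chi j)" and Q': "Q' = (g [^] i', chi j')"
    using decode_encode[OF assms(1)] decode_encode[OF assms(2)] ij ij' by (simp_all add: decode_def)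
  have "\<phi> (fst Q) = fst Q' \<longleftrightarrow> [a * i = i'] (mod m)"
    by (simp add: Q Q' \<phi> gen_pow_eq_iff)
  also have "\<dots> \<longleftrightarrow> i' = a * i mod m" using ij'(2) by (auto simp: cong_def)
  finally have fst_iff: "\<phi> (fst Q) = fst Q' \<longleftrightarrow> i' = a * i mod m" .
  have "(\<forall>x\<in>carrier G. snd Q' (\<phi> x) = snd Q x) \<longleftrightarrow> (\<forall>k\<in>{..<m}. [j' * (a * k) = j * k] (mod m))"
    by (simp add: carrier_eq Q Q' \<phi> chi_gen_pow root_pow_eq_iff)
  also have "\<dots> \<longleftrightarrow> [j' * a = j] (mod m)"
  proof
    assume "\<forall>k\<in>{..<m}. [j' * (a * k) = j * k] (mod m)"
    then have "[j' * (a * 1) = j * 1] (mod m)" using m_gt_1 by (metis lessThan_iff)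
    then show "[j' * a = j] (mod m)" by simp
  next
    assume "[j' * a = j] (mod m)"
    then show "\<forall>k\<in>{..<m}. [j' * (a * k) = j * k] (mod m)"
      by (simp add: cong_scalar_right flip: mult.assoc)
  qed
  also have "\<dots> \<longleftrightarrow> j' = unit_inverse m a * j mod m"
  proof -
    have inv: "[a * unit_inverse m a = 1] (mod m)"
      using mult_unit_inverse[OF m_gt_1 assms(3)] m_gt_1 by (simp add: cong_def)
    have "[j' * a = j] (mod m) \<longleftrightarrow> [a * j' = a * (unit_inverse m a * j)] (mod m)"
      using cong_scalar_right[OF inv, of j]
      by (metis mult.commute mult.assoc mult_1 cong_sym cong_trans)
    also have "\<dots> \<longleftrightarrow> [j' = unit_inverse m a * j] (mod m)"
      using assms(3) by (simp add: cong_mult_lcancel_nat in_totatives_iff)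
    also have "\<dots> \<longleftrightarrow> j' = unit_inverse m a * j mod m" using ij'(3) by (simp add: cong_def)
    finally show ?thesis .
  qed
  finally show ?thesis using fst_iff ij ij' by (simp add: unit_act_def)
qed

section \<open>Isomorphism of element systems as an orbit relation on multisets\<close>

definition esc_mset :: "nat \<Rightarrow> (nat \<Rightarrow> 'a) \<times> (nat \<Rightarrow> 'a \<Rightarrow> 'b) \<Rightarrow> (nat \<times> nat) multiset" where
  "esc_mset n A = image_mset (\<lambda>i. encode (fst A i, snd A i)) (mset_set {1..n})"

lemma esc_apply:
  assumes "A \<in> ESC G F {1..n}" "i \<in> {1..n}"
  shows "(fst A i, snd A i) \<in> carrier G \<times> characters G F"
  using assms by (auto simp: ESC_def PiE_iff)

text \<open>The bijection \<sigma> only reorders the codes and disappears in the multiset, while the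
  automorphism becomes a unit. Conversely a unit yields an automorphism, and equality of multisets
  yields \<sigma>.\<close>

lemma ESC_isomorphic_iff:
  assumes A: "A \<in> ESC G F {1..n}" and B: "B \<in> ESC G F {1..n}"
  shows "ESC_isomorphic G {1..n} A G {1..n} B \<longleftrightarrow>
    (\<exists>a\<in>totatives m. esc_mset n B = image_mset (unit_act m a) (esc_mset n A))"
proof
  assume "ESC_isomorphic G {1..n} A G {1..n} B"
  then obtain \<phi> \<sigma> where \<phi>: "\<phi> \<in> iso G G" and \<sigma>: "bij_betw \<sigma> {1..n} {1..n}"
    and eq: "\<And>i. i \<in> {1..n} \<Longrightarrow> \<phi> (fst A i) = fst B (\<sigma> i) \<and>
      (\<forall>x\<in>carrier G. snd B (\<sigma> i) (\<phi> x) = snd A i x)"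
    unfolding ESC_isomorphic_def case_prod_unfold by blast
  obtain a where a: "a \<in> totatives m" "\<And>i::nat. \<phi> (g [^] i) = g [^] (a * i)"
    using iso_gen_pow[OF \<phi>] by metis
  have "encode (fst B (\<sigma> i), snd B (\<sigma> i)) = unit_act m a (encode (fst A i, snd A i))"
    if i: "i \<in> {1..n}" for i
    using encode_action[OF esc_apply[OF A i] esc_apply[OF B bij_betw_apply[OF \<sigma> i]] a] eq[OF i]
    unfolding fst_conv snd_conv by blast
  then have "image_mset (\<lambda>i. encode (fst B (\<sigma> i), snd B (\<sigma> i))) (mset_set {1..n}) =
      image_mset (\<lambda>i. unit_act m a (encode (fst A i, snd A i))) (mset_set {1..n})"
    by (intro image_mset_cong) (simp only: finite_set_mset_mset_set finite_atLeastAtMost)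
  moreover have "esc_mset n B = image_mset (\<lambda>i. encode (fst B (\<sigma> i), snd B (\<sigma> i))) (mset_set {1..n})"
  proof -
    have "mset_set {1..n} = image_mset \<sigma> (mset_set {1..n})"
      using \<sigma> by (simp add: image_mset_mset_set bij_betw_def)
    then have "esc_mset n B = image_mset (\<lambda>i. encode (fst B i, snd B i)) (image_mset \<sigma> (mset_set {1..n}))"
      unfolding esc_mset_def by (rule arg_cong)
    then show ?thesis by (simp add: multiset.map_comp o_def)
  qed
  ultimately show "\<exists>a\<in>totatives m. esc_mset n B = image_mset (unit_act m a) (esc_mset n A)"
    using a(1) by (intro bexI[of _ a]) (simp_all only: esc_mset_def multiset.map_comp o_def)
next
  assume "\<exists>a\<in>totatives m. esc_mset n B = image_mset (unit_act m a) (esc_mset n A)"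
  then obtain a where a: "a \<in> totatives m"
    and eq: "esc_mset n B = image_mset (unit_act m a) (esc_mset n A)" by blast
  obtain \<phi> where \<phi>: "\<phi> \<in> iso G G" "\<And>i::nat. \<phi> (g [^] i) = g [^] (a * i)"
    using ex_iso_gen_pow[OF a] by metis
  have "image_mset (\<lambda>i. unit_act m a (encode (fst A i, snd A i))) (mset_set {1..n}) =
      image_mset (\<lambda>i. encode (fst B i, snd B i)) (mset_set {1..n})"
    using eq by (simp add: esc_mset_def multiset.map_comp o_def)
  \<comment> \<open>Two families on the same finite index set with the same multiset of values
    differ by a permutation of the indices.\<close>
  then obtain \<sigma> where \<sigma>: "\<sigma> permutes {1..n}"
    and \<sigma>_eq: "\<forall>i\<in>{1..n}. unit_act m a (encode (fst A i, snd A i)) = encode (fst B (\<sigma> i), snd B (\<sigma> i))"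
    by (rule image_mset_eq_implies_permutes[OF finite_atLeastAtMost])
  have "\<phi> (fst A i) = fst B (\<sigma> i) \<and> (\<forall>x\<in>carrier G. snd B (\<sigma> i) (\<phi> x) = snd A i x)"
    if i: "i \<in> {1..n}" for i
  proof -
    have "\<sigma> i \<in> {1..n}" using permutes_in_image[OF \<sigma>] i by blast
    then show ?thesis
      using encode_action[OF esc_apply[OF A i] esc_apply[OF B] a \<phi>(2)] \<sigma>_eq i
      unfolding fst_conv snd_conv by metis
  qed
  then show "ESC_isomorphic G {1..n} A G {1..n} B"
    using \<phi>(1) permutes_imp_bij[OF \<sigma>] unfolding ESC_isomorphic_def case_prod_unfold by blast
qed

lemma esc_mset_image: "esc_mset n ` ESC G F {1..n} = multisets_of_size ({..<m} \<times> {..<m}) n"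
proof
  show "esc_mset n ` ESC G F {1..n} \<subseteq> multisets_of_size ({..<m} \<times> {..<m}) n"
  proof
    fix M assume "M \<in> esc_mset n ` ESC G F {1..n}"
    then obtain A where "A \<in> ESC G F {1..n}" "M = esc_mset n A" by blast
    then have "encode (fst A i, snd A i) \<in> {..<m} \<times> {..<m}" if "i \<in> {1..n}" for i
      using encode_in esc_apply that by blast
    then have "set_mset (esc_mset n A) \<subseteq> {..<m} \<times> {..<m}"
      unfolding esc_mset_def set_image_mset finite_set_mset_mset_set[OF finite_atLeastAtMost]
      by (rule image_subsetI)
    moreover have "size (esc_mset n A) = n" by (simp add: esc_mset_def)
    ultimately show "M \<in> multisets_of_size ({..<m} \<times> {..<m}) n"
      using \<open>M = esc_mset n A\<close> by (simp add: multisets_of_size_def)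
  qed
  show "multisets_of_size ({..<m} \<times> {..<m}) n \<subseteq> esc_mset n ` ESC G F {1..n}"
  proof
    fix M :: "(nat \<times> nat) multiset" assume M: "M \<in> multisets_of_size ({..<m} \<times> {..<m}) n"
    obtain xs where xs: "mset xs = M" using ex_mset by blast
    then have len: "length xs = n" and sub: "set xs \<subseteq> {..<m} \<times> {..<m}"
      using M by (auto simp: multisets_of_size_def)
    \<comment> \<open>The indices start at 1 and list positions at 0.\<close>
    define h where "h = (\<lambda>i. decode (xs ! (i - 1)))"
    define A where "A = (\<lambda>i\<in>{1..n}. fst (h i), \<lambda>i\<in>{1..n}. snd (h i))"
    have nth: "xs ! (i - 1) \<in> {..<m} \<times> {..<m}" if "i \<in> {1..n}" for i
    proof -
      have "xs ! (i - 1) \<in> set xs" using that len by (intro nth_mem) auto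
      with sub show ?thesis by blast
    qed
    have "h i \<in> carrier G \<times> characters G F" if "i \<in> {1..n}" for i
      unfolding h_def using bij_betw_apply[OF bij_betw_decode nth[OF that]] .
    then have "A \<in> ESC G F {1..n}" by (auto simp: A_def ESC_def mem_Times_iff)
    moreover have "esc_mset n A = M"
    proof -
      have "esc_mset n A = image_mset (\<lambda>i. xs ! (i - 1)) (mset_set {1..n})"
        unfolding esc_mset_def using nth
        by (intro image_mset_cong) (simp add: A_def h_def encode_decode)
      also have "mset_set {1..n} = mset (map Suc [0..<n])"
        by (simp add: map_Suc_upt mset_upt atLeastLessThanSuc_atLeastAtMost del: upt_Suc)
      also have "image_mset (\<lambda>i. xs ! (i - 1)) (mset (map Suc [0..<n])) = mset (map (\<lambda>i. xs ! i) [0..<n])"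
        by (simp add: multiset.map_comp o_def)
      also have "map (\<lambda>i. xs ! i) [0..<n] = xs" using map_nth[of xs] len by simp
      finally show ?thesis using xs by simp
    qed
    ultimately show "M \<in> esc_mset n ` ESC G F {1..n}" by blast
  qed
qed

text \<open>\<open>esc_mset\<close> is onto the multisets of size \<open>n\<close> and pulls the
  orbit relation back to isomorphism, so the two quotients have equally many classes and the orbit
  count applies.\<close>

lemma num_ESC_classes_formula:
  "real (totient m) * real (num_ESC_classes G F n) =
    (\<Sum>a\<in>totatives m. \<Sum>l\<in>cycle_types n.
       (\<Prod>j=1..n. real (gcd (a ^ j - 1) m) ^ (2 * l j)) / real (z_cycle n l))"
proof -
  have "num_ESC_classes G F n = card (multisets_of_size ({..<m} \<times> {..<m}) n // unit_orbit_rel m n)"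
    unfolding num_ESC_classes_def
  proof (rule card_quotient_reindex)
    show "esc_mset n ` ESC G F {1..n} = multisets_of_size ({..<m} \<times> {..<m}) n"
      by (rule esc_mset_image)
  next
    fix A B assume AB: "A \<in> ESC G F {1..n}" "B \<in> ESC G F {1..n}"
    then have "esc_mset n A \<in> multisets_of_size ({..<m} \<times> {..<m}) n"
      "esc_mset n B \<in> multisets_of_size ({..<m} \<times> {..<m}) n" using esc_mset_image by blast+
    then show "(A, B) \<in> {(A, B). A \<in> ESC G F {1..n} \<and> B \<in> ESC G F {1..n} \<and>
                ESC_isomorphic G {1..n} A G {1..n} B} \<longleftrightarrow>
          (esc_mset n A, esc_mset n B) \<in> unit_orbit_rel m n"
      using ESC_isomorphic_iff AB by (simp add: unit_orbit_rel_def)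
  qed (auto simp: unit_orbit_rel_def)
  then show ?thesis using card_unit_orbits_formula[OF m_gt_1] by simp
qed

end

section \<open>Orders of units modulo prime powers\<close>

text \<open>The gcd divides \<open>p ^ e\<close>, hence is some \<open>p ^ w\<close>, and
  \<open>w\<close> and \<open>v\<close> are the same threshold. The test starts at
  \<open>i = 1\<close>, where the criteria applied later are available; \<open>i = 0\<close> is
  trivial.\<close>

lemma gcd_prime_power_eqI:
  fixes p x v :: nat
  assumes "Factorial_Ring.prime p" "v \<le> e"
    and "\<And>i. 1 \<le> i \<Longrightarrow> i \<le> e \<Longrightarrow> p ^ i dvd x \<longleftrightarrow> i \<le> v"
  shows "gcd x (p ^ e) = p ^ v"
proof -
  have p: "p > 1" using assms(1) by (rule prime_gt_1_nat)
  obtain w where w: "w \<le> e" "gcd x (p ^ e) = p ^ w"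
    using iffD1[OF divides_primepow_nat[OF assms(1)], of "gcd x (p ^ e)" e] gcd_dvd2 by blast
  have dvd_iff: "p ^ i dvd x \<longleftrightarrow> i \<le> w" if "i \<le> e" for i
  proof -
    have "p ^ i dvd x \<longleftrightarrow> p ^ i dvd gcd x (p ^ e)"
      using le_imp_power_dvd[OF that, of p] by simp
    also have "\<dots> \<longleftrightarrow> i \<le> w"
      unfolding w(2) using p by (blast intro: le_imp_power_dvd dest: power_dvd_imp_le)
    finally show ?thesis .
  qed
  have "i \<le> v \<longleftrightarrow> i \<le> w" if "i \<le> e" for i
    using that dvd_iff[of i] assms(3)[of i] by (cases "i = 0") auto
  from this[of v] this[of w] have "v = w" using assms(2) w(1) by simp
  then show ?thesis using w by simp
qed

text \<open>In b^p - 1 = (b - 1)(1 + b + ... + b^(p-1)) the second factor has \<open>p\<close>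
  terms, each congruent to 1 modulo \<open>p\<close>, and so contributes one more factor
  \<open>p\<close>.\<close>

lemma cong_1_power_prime_step:
  fixes b p i :: nat
  assumes "i \<ge> 1" "[b = 1] (mod p ^ i)"
  shows "[b ^ p = 1] (mod p ^ Suc i)"
proof -
  have dvd: "int p ^ i dvd int b - 1"
  proof -
    have "[int b = int 1] (mod int (p ^ i))" using assms(2) by (simp only: cong_int_iff)
    then show ?thesis by (simp add: cong_iff_dvd_diff)
  qed
  have "[int b = 1] (mod int p)"
    using dvd assms(1) dvd_trans[OF dvd_power[of i "int p"] dvd] by (simp add: cong_iff_dvd_diff)
  then have "[(\<Sum>t<p. int b ^ t) = (\<Sum>t<p. 1 ^ t)] (mod int p)"
    by (intro cong_sum cong_pow)
  then have "int p dvd (\<Sum>t<p. int b ^ t)" by (simp add: cong_dvd_iff)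
  with dvd have "int p ^ i * int p dvd (int b - 1) * (\<Sum>t<p. int b ^ t)" by (rule mult_dvd_mono)
  then have "int p ^ Suc i dvd int b ^ p - 1" by (simp add: power_diff_1_eq mult.commute)
  then have "[int (b ^ p) = int 1] (mod int (p ^ Suc i))" by (simp add: cong_iff_dvd_diff)
  then show ?thesis by (simp only: cong_int_iff)
qed

lemma cong_1_power_prime_power:
  fixes b p i :: nat
  assumes "i \<ge> 1" "[b = 1] (mod p ^ i)"
  shows "[b ^ (p ^ t) = 1] (mod p ^ (i + t))"
proof (induction t)
  case (Suc t)
  have "[(b ^ (p ^ t)) ^ p = 1] (mod p ^ Suc (i + t))"
    using cong_1_power_prime_step[OF _ Suc] assms(1) by simp
  then show ?case by (simp add: power_mult[symmetric] mult.commute)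
qed (use assms in simp)

lemma cong_1_mod_iff_dvd:
  fixes a j n :: nat
  assumes "a > 0"
  shows "[a ^ j = 1] (mod n) \<longleftrightarrow> n dvd a ^ j - 1"
  using assms by (simp add: cong_altdef_nat)

text \<open>Raising to the power p^(e-i) lifts a congruence to 1 from modulus p^i to p^e. The
  converse uses the primitive root: if \<open>a\<close> is \<open>g ^ x\<close>, then
  \<open>totient (p ^ e)\<close> divides x j p^(e-i). Cancelling p^(e-i) leaves
  \<open>totient (p ^ i)\<close> dividing \<open>x * j\<close>, and Euler's theorem modulo p^i
  concludes.\<close>

lemma prime_power_dvd_iff_ord_dvd:
  fixes p e i a j :: nat
  assumes p: "Factorial_Ring.prime p" and g: "residue_primroot (p ^ e) g"
    and a: "a \<in> totatives (p ^ e)" and i: "1 \<le> i" "i \<le> e"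
  shows "p ^ i dvd a ^ j - 1 \<longleftrightarrow> ord (p ^ e) a dvd j * p ^ (e - i)"
proof -
  have p1: "p > 1" using p by (rule prime_gt_1_nat)
  then have m1: "p ^ e > 1" using i by (intro one_less_power) auto
  have "p ^ i dvd a ^ j - 1 \<longleftrightarrow> [a ^ j = 1] (mod p ^ i)"
    using cong_1_mod_iff_dvd[of a j "p ^ i"] a by (simp add: in_totatives_iff)
  also have "\<dots> \<longleftrightarrow> [a ^ (j * p ^ (e - i)) = 1] (mod p ^ e)"
  proof
    assume "[a ^ j = 1] (mod p ^ i)"
    from cong_1_power_prime_power[OF i(1) this, of "e - i"]
    show "[a ^ (j * p ^ (e - i)) = 1] (mod p ^ e)" using i by (simp add: power_mult)
  next
    assume *: "[a ^ (j * p ^ (e - i)) = 1] (mod p ^ e)"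
    obtain x where x: "a = g ^ x mod p ^ e"
      using a residue_primroot_is_generator[OF m1 g] by (auto simp: bij_betw_def)
    have "[g ^ (x * (j * p ^ (e - i))) = 1] (mod p ^ e)"
    proof -
      have "[(g ^ x) ^ (j * p ^ (e - i)) = a ^ (j * p ^ (e - i))] (mod p ^ e)"
        unfolding x by (intro cong_pow) simp
      from cong_trans[OF this *] show ?thesis by (simp only: power_mult)
    qed
    then have "totient (p ^ e) dvd x * (j * p ^ (e - i))"
      using g unfolding ord_divides by (simp add: residue_primroot_def)
    moreover have "totient (p ^ e) = totient (p ^ i) * p ^ (e - i)"
    proof -
      have "p ^ (e - 1) = p ^ (i - 1) * p ^ (e - i)" using i by (simp flip: power_add)
      then show ?thesis using i p by (simp add: totient_prime_power)
    qed
    ultimately have "totient (p ^ i) * p ^ (e - i) dvd (x * j) * p ^ (e - i)"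
      by (simp add: mult.assoc)
    then have tot: "totient (p ^ i) dvd x * j" using p1 by simp
    have "coprime g (p ^ i)"
      using g i by (auto simp: residue_primroot_def coprime_commute coprime_power_left_iff)
    then have "ord (p ^ i) g dvd totient (p ^ i)"
      by (intro order_divides_totient) (simp add: coprime_commute)
    with tot have "[g ^ (x * j) = 1] (mod p ^ i)"
      unfolding ord_divides by (rule dvd_trans[rotated])
    moreover have "[a = g ^ x] (mod p ^ e)" by (simp add: x)
    then have "[a = g ^ x] (mod p ^ i)"
      by (rule cong_dvd_modulus_nat) (use i in \<open>simp add: le_imp_power_dvd\<close>)
    then have "[a ^ j = g ^ (x * j)] (mod p ^ i)"
      unfolding power_mult by (rule cong_pow)
    ultimately show "[a ^ j = 1] (mod p ^ i)" by (metis cong_trans)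
  qed
  also have "\<dots> \<longleftrightarrow> ord (p ^ e) a dvd j * p ^ (e - i)" by (rule ord_divides)
  finally show ?thesis .
qed

text \<open>The valuation, capped at \<open>e\<close>, of \<open>a\<^sup>j - 1\<close> for a unit \<open>a\<close> of order \<open>d p\<^sup>e\<^sup>-\<^sup>k\<close> modulo \<open>p\<^sup>e\<close>.\<close>

definition cyclic_val :: "nat \<Rightarrow> nat \<Rightarrow> nat \<Rightarrow> nat \<Rightarrow> nat \<Rightarrow> nat" where
  "cyclic_val p e k d j = (if d dvd j then min e (k + multiplicity p j) else 0)"

lemma coprime_dvd_pred:
  fixes d p :: nat
  assumes "p > 1" "d dvd p - 1"
  shows "coprime d p"
proof -
  have "coprime (p - 1) p" using assms(1) coprime_diff_one_left_nat[of p] by simp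
  then show ?thesis using assms(2) coprime_divisors dvd_refl by blast
qed

text \<open>Since \<open>d\<close> is coprime to \<open>p\<close>, the order condition splits into
  \<open>d\<close> dividing \<open>j\<close> and a comparison of exponents of \<open>p\<close>. If
  \<open>d\<close> does not divide \<open>j\<close>, no \<open>i \<ge> 1\<close> qualifies and the
  gcd is 1.\<close>

lemma gcd_power_minus_1_cyclic:
  assumes p: "Factorial_Ring.prime p" and g: "residue_primroot (p ^ e) g"
    and a: "a \<in> totatives (p ^ e)" and k: "1 \<le> k" "k \<le> e" and d: "d dvd p - 1"
    and ord_a: "ord (p ^ e) a = d * p ^ (e - k)" and j: "j > 0"
  shows "gcd (a ^ j - 1) (p ^ e) = p ^ cyclic_val p e k d j"
proof (rule gcd_prime_power_eqI[OF p])
  show "cyclic_val p e k d j \<le> e" by (simp add: cyclic_val_def)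
  fix i assume i: "1 \<le> i" "i \<le> e"
  have p1: "p > 1" using p by (rule prime_gt_1_nat)
  have cop: "coprime d p" by (rule coprime_dvd_pred[OF p1 d])
  have "p ^ i dvd a ^ j - 1 \<longleftrightarrow> d * p ^ (e - k) dvd j * p ^ (e - i)"
    using prime_power_dvd_iff_ord_dvd[OF p g a i] ord_a by simp
  also have "\<dots> \<longleftrightarrow> d dvd j * p ^ (e - i) \<and> p ^ (e - k) dvd j * p ^ (e - i)"
    using cop by (auto intro: divides_mult dvd_mult_left dvd_mult_right)
  also have "d dvd j * p ^ (e - i) \<longleftrightarrow> d dvd j"
    using cop by (simp add: coprime_dvd_mult_left_iff)
  also have "p ^ (e - k) dvd j * p ^ (e - i) \<longleftrightarrow> e - k \<le> multiplicity p j + (e - i)"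
  proof -
    have "multiplicity p (j * p ^ (e - i)) = multiplicity p j + (e - i)"
      using p j by (subst prime_elem_multiplicity_mult_distrib) (auto simp: multiplicity_same_power)
    then show ?thesis
      using p1 j p by (subst power_dvd_iff_le_multiplicity) auto
  qed
  \<comment> \<open>Because \<open>i\<close> and \<open>k\<close> are at most \<open>e\<close>, no
    subtraction is truncated and the inequality means
    \<open>i \<le> k + multiplicity p j\<close>.\<close>
  also have "d dvd j \<and> e - k \<le> multiplicity p j + (e - i) \<longleftrightarrow> i \<le> cyclic_val p e k d j"
    using i k by (auto simp: cyclic_val_def)
  finally show "p ^ i dvd a ^ j - 1 \<longleftrightarrow> i \<le> cyclic_val p e k d j" .
qed

section \<open>Counting units by their order\<close>

text \<open>The order of \<open>g ^ i\<close> is \<open>N\<close> divided by \<open>gcd i N\<close>,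
  so order \<open>D\<close> amounts to \<open>gcd i N = N div D\<close>, and the exponents with a
  prescribed gcd are counted by the totient.\<close>

lemma card_elements_with_ord_primroot:
  assumes m: "m > 1" and g: "residue_primroot m g" and D: "D dvd totient m"
  shows "card {a \<in> totatives m. ord m a = D} = totient D"
proof -
  define N where "N = totient m"
  have N: "N > 0" using m by (simp add: N_def)
  have gm: "coprime m g" "ord m g = N" using g by (auto simp: residue_primroot_def N_def)
  have D0: "D > 0" using D N by (intro Nat.gr0I) (auto simp: N_def)
  have inj: "inj_on (\<lambda>i. g ^ i mod m) {0<..N}"
  proof (rule inj_onI)
    fix x y assume xy: "x \<in> {0<..N}" "y \<in> {0<..N}" and "g ^ x mod m = g ^ y mod m"
    then have "[x = y] (mod N)" using order_divides_expdiff[of m g x y] gm by (simp add: cong_def)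
    \<comment> \<open>The exponents run from 1 to \<open>N\<close>, so the residue 0 is represented
      by \<open>N\<close> and is treated separately.\<close>
    moreover have "x < N \<or> x = N" "y < N \<or> y = N" using xy by auto
    ultimately show "x = y" using xy by (auto simp: cong_def)
  qed
  have img: "(\<lambda>i. g ^ i mod m) ` {0<..N} = totatives m"
  proof (rule card_subset_eq)
    show "(\<lambda>i. g ^ i mod m) ` {0<..N} \<subseteq> totatives m"
      using power_in_totatives[of m g] m gm by auto
    show "card ((\<lambda>i. g ^ i mod m) ` {0<..N}) = card (totatives m)"
      using inj by (simp add: card_image N_def totient_def)
  qed simp
  have "bij_betw (\<lambda>i. g ^ i mod m) {i \<in> {0<..N}. gcd i N = N div D} {a \<in> totatives m. ord m a = D}"
    unfolding bij_betw_def
  proof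
    show "inj_on (\<lambda>i. g ^ i mod m) {i \<in> {0<..N}. gcd i N = N div D}"
      by (rule inj_on_subset[OF inj]) auto
    have iff: "gcd i N = N div D \<longleftrightarrow> ord m (g ^ i mod m) = D" for i
    proof -
      have "ord m (g ^ i) * gcd i N = N" using ord_power_aux[of m g i] gm by simp
      moreover have "D * (N div D) = N" using D by (simp add: N_def)
      moreover have "N div D > 0" using calculation(2) N by (intro Nat.gr0I) simp
      ultimately show ?thesis using D0 unfolding ord_mod
        by (metis mult_cancel1 mult_cancel2 less_numeral_extra(3))
    qed
    show "(\<lambda>i. g ^ i mod m) ` {i \<in> {0<..N}. gcd i N = N div D} = {a \<in> totatives m. ord m a = D}"
      unfolding img[symmetric] using iff by auto
  qed
  then have "card {a \<in> totatives m. ord m a = D} = card {i \<in> {0<..N}. gcd i N = N div D}"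
    by (simp add: bij_betw_same_card)
  also have "\<dots> = totient (N div (N div D))"
    using N D by (intro card_gcd_eq_totient) (auto simp: N_def div_dvd_iff_mult)
  also have "N div (N div D) = D"
  proof -
    obtain k where k: "N = D * k" using D by (auto simp: N_def)
    with N have "k > 0" by (intro Nat.gr0I) simp
    with D0 show ?thesis by (simp add: k)
  qed
  finally show ?thesis .
qed

text \<open>Every divisor is uniquely d p^s, with \<open>d\<close> dividing \<open>q\<close> and
  \<open>s \<le> r\<close>. It serves to split the orders dividing p^(e-1) (p - 1).\<close>

lemma sum_divisors_coprime_prime_power:
  fixes h :: "nat \<Rightarrow> real" and p q s :: nat
  assumes p: "Factorial_Ring.prime p" and cop: "coprime q p"
  shows "(\<Sum>D | D dvd p ^ r * q. h D) = (\<Sum>s\<le>r. \<Sum>d | d dvd q. h (d * p ^ s))"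
proof -
  have p1: "p > 1" using p by (rule prime_gt_1_nat)
  have "bij_betw (\<lambda>(s, d). d * p ^ s) ({..r} \<times> {d. d dvd q}) {D. D dvd p ^ r * q}"
    unfolding bij_betw_def
  proof
    show "inj_on (\<lambda>(s, d). d * p ^ s) ({..r} \<times> {d. d dvd q})"
    proof (rule inj_onI, clarsimp)
      fix s d s' d' assume *: "d dvd q" "d' dvd q" "d * p ^ s = d' * p ^ s'"
      then have "coprime d (p ^ s')" "coprime d' (p ^ s)"
        using coprime_divisors[OF _ dvd_refl cop] by auto
      moreover have "d dvd d' * p ^ s'" unfolding *(3)[symmetric] by simp
      moreover have "d' dvd d * p ^ s" unfolding *(3) by simp
      ultimately have "d dvd d'" "d' dvd d" using coprime_dvd_mult_left_iff by blast+
      then have "d = d'" by (rule dvd_antisym)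
      moreover have "d > 0 \<or> d = 0" by auto
      moreover have "q \<noteq> 0" using cop p1 by (intro notI) simp
      ultimately show "s = s' \<and> d = d'" using * p1 by auto
    qed
    show "(\<lambda>(s, d). d * p ^ s) ` ({..r} \<times> {d. d dvd q}) = {D. D dvd p ^ r * q}"
    proof (intro equalityI subsetI)
      fix D assume "D \<in> (\<lambda>(s, d). d * p ^ s) ` ({..r} \<times> {d. d dvd q})"
      then show "D \<in> {D. D dvd p ^ r * q}"
        by (auto simp: mult.commute[of "p ^ r"] intro!: mult_dvd_mono le_imp_power_dvd)
    next
      fix D assume "D \<in> {D. D dvd p ^ r * q}"
      then obtain u d where ud: "D = u * d" "u dvd p ^ r" "d dvd q"
        using dvd_productE by blast
      then obtain s where "s \<le> r" "u = p ^ s" using divides_primepow_nat[OF p] by blast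
      then show "D \<in> (\<lambda>(s, d). d * p ^ s) ` ({..r} \<times> {d. d dvd q})"
        using ud by (auto simp: image_iff mult.commute)
    qed
  qed
  from sum.reindex_bij_betw[OF this, of h, symmetric]
  show ?thesis by (simp add: sum.cartesian_product case_prod_unfold)
qed

section \<open>The exponents as sums of valuations\<close>

text \<open>Multiplication by p^s d maps the \<open>t\<close> prime to \<open>p\<close> bijectively
  to the multiples \<open>j\<close> of \<open>d\<close> with valuation exactly \<open>s\<close>, as
  \<open>d\<close> contributes no factor \<open>p\<close>. All layers of \<open>f_exp\<close> thus
  become sums over one range of \<open>j\<close>.\<close>

lemma sum_multiples_multiplicity:
  fixes l :: "nat \<Rightarrow> nat"
  assumes p: "Factorial_Ring.prime p" and d: "coprime d p" "d > 0"
  shows "(\<Sum>t | t \<in> {1..n div (p ^ s * d)} \<and> coprime t p. l (t * p ^ s * d)) =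
    (\<Sum>j=1..n. if d dvd j \<and> multiplicity p j = s then l j else 0)"
proof -
  have p1: "p > 1" using p by (rule prime_gt_1_nat)
  define q where "q = p ^ s * d"
  have q: "q > 0" using p1 d by (simp add: q_def)
  have "(\<Sum>t | t \<in> {1..n div q} \<and> coprime t p. l (t * q)) =
      (\<Sum>j\<in>{j\<in>{1..n}. d dvd j \<and> multiplicity p j = s}. l j)"
  proof (rule sum.reindex_bij_witness[where i = "\<lambda>j. j div q" and j = "\<lambda>t. t * q"])
    fix t assume t: "t \<in> {t. t \<in> {1..n div q} \<and> coprime t p}"
    have ndvd: "\<not> p dvd x" if "coprime x p" for x
      using coprime_common_divisor[OF that, of p] p1 by auto
    have "\<not> p dvd t" "\<not> p dvd d" using t d(1) ndvd by auto
    then have "\<not> p dvd t * d" using p by (simp add: prime_dvd_mult_iff)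
    moreover have "t * q = p ^ s * (t * d)" by (simp add: q_def)
    ultimately have "multiplicity p (t * q) = s"
      using p1 by (intro multiplicity_eqI) (auto simp: mult.commute)
    moreover have "t * q \<le> n" using t q by (simp add: less_eq_div_iff_mult_less_eq)
    ultimately show "t * q \<in> {j\<in>{1..n}. d dvd j \<and> multiplicity p j = s}"
      using t q by (auto simp: q_def)
  next
    fix j assume j: "j \<in> {j\<in>{1..n}. d dvd j \<and> multiplicity p j = s}"
    then have "p ^ s dvd j" using multiplicity_dvd by auto
    then have "q dvd j" unfolding q_def using j d(1) by (auto intro!: divides_mult simp: coprime_commute)
    then obtain t where t: "j = t * q" by (metis dvd_div_mult_self)
    then have t_bounds: "t \<ge> 1" "t \<le> n div q"
      using j q by (auto simp: less_eq_div_iff_mult_less_eq Suc_le_eq)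
    have "\<not> p dvd t"
    proof
      assume "p dvd t"
      then have "p ^ Suc s dvd j" by (auto simp: t q_def elim!: dvdE)
      then show False
        using j p p1 power_dvd_iff_le_multiplicity[of j p "Suc s"] by auto
    qed
    then have "coprime t p" using p by (metis coprime_commute prime_imp_coprime)
    then show "j div q \<in> {t. t \<in> {1..n div q} \<and> coprime t p}"
      using t t_bounds q by simp
    show "j div q * q = j" using t q by simp
  qed (use q in auto)
  also have "\<dots> = (\<Sum>j=1..n. if d dvd j \<and> multiplicity p j = s then l j else 0)"
    by (simp only: sum.inter_filter[OF finite_atLeastAtMost])
  finally show ?thesis by (simp add: q_def mult.assoc)
qed

lemma sum_multiples:
  fixes l :: "nat \<Rightarrow> nat"
  assumes "q > 0"
  shows "(\<Sum>t=1..n div q. l (t * q)) = (\<Sum>j=1..n. if q dvd j then l j else 0)"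
proof -
  have "(\<Sum>t=1..n div q. l (t * q)) = (\<Sum>j\<in>{j\<in>{1..n}. q dvd j}. l j)"
  proof (rule sum.reindex_bij_witness[where i = "\<lambda>j. j div q" and j = "\<lambda>t. t * q"])
    fix j assume j: "j \<in> {j\<in>{1..n}. q dvd j}"
    define t where "t = j div q"
    have t: "j = t * q" using j by (simp add: t_def)
    then have "t \<ge> 1" "t \<le> n div q"
      using j assms by (auto simp: less_eq_div_iff_mult_less_eq Suc_le_eq)
    then show "j div q \<in> {1..n div q}"
      using t assms by simp
  qed (use assms in \<open>auto simp: less_eq_div_iff_mult_less_eq\<close>)
  then show ?thesis by (simp only: sum.inter_filter[OF finite_atLeastAtMost])
qed

text \<open>A multiple \<open>j\<close> of \<open>d\<close> with valuation \<open>v\<close> occurs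
  once: in the layer \<open>s = v\<close> with coefficient \<open>k + v\<close> if
  \<open>v < e - k\<close>, and otherwise in the last sum with coefficient \<open>e\<close>. Both
  cases are \<open>min e (k + v)\<close>.\<close>

lemma f_exp_eq_sum_cyclic_val:
  assumes p: "Factorial_Ring.prime p" and d: "coprime d p" "d > 0" and k: "k \<le> e"
  shows "f_exp p e n k d l = (\<Sum>j=1..n. cyclic_val p e k d j * l j)"
proof -
  have p1: "p > 1" using p by (rule prime_gt_1_nat)
  have "f_exp p e n k d l =
      (\<Sum>s<e - k. (k + s) * (\<Sum>j=1..n. if d dvd j \<and> multiplicity p j = s then l j else 0)) +
      e * (\<Sum>j=1..n. if p ^ (e - k) * d dvd j then l j else 0)"
    unfolding f_exp_def sum_multiples_multiplicity[OF p d]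
    using sum_multiples[of "p ^ (e - k) * d" l n] p1 d by (simp add: mult.assoc)
  also have "\<dots> = (\<Sum>j=1..n. (\<Sum>s<e - k. (k + s) * (if d dvd j \<and> multiplicity p j = s then l j else 0)) +
      e * (if p ^ (e - k) * d dvd j then l j else 0))"
    unfolding sum_distrib_left sum.distrib by (subst sum.swap) simp
  also have "\<dots> = (\<Sum>j=1..n. cyclic_val p e k d j * l j)"
  proof (rule sum.cong)
    fix j assume j: "j \<in> {1..n}"
    define v where "v = multiplicity p j"
    have "p ^ (e - k) * d dvd j \<longleftrightarrow> p ^ (e - k) dvd j \<and> d dvd j"
      using d(1) by (auto intro!: divides_mult simp: coprime_commute dest: dvd_mult_left dvd_mult_right)
    also have "p ^ (e - k) dvd j \<longleftrightarrow> e - k \<le> v"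
      unfolding v_def using p p1 j by (intro power_dvd_iff_le_multiplicity) auto
    finally have dvd: "p ^ (e - k) * d dvd j \<longleftrightarrow> e - k \<le> v \<and> d dvd j" .
    have "(\<Sum>s<e - k. (k + s) * (if d dvd j \<and> v = s then l j else 0)) =
        (\<Sum>s<e - k. if v = s then (if d dvd j then (k + s) * l j else 0) else 0)"
      by (intro sum.cong) auto
    also have "\<dots> = (if v < e - k then (if d dvd j then (k + v) * l j else 0) else 0)"
      by (simp add: sum.delta')
    finally show "(\<Sum>s<e - k. (k + s) * (if d dvd j \<and> multiplicity p j = s then l j else 0)) +
      e * (if p ^ (e - k) * d dvd j then l j else 0) = cyclic_val p e k d j * l j"
      using k by (auto simp: dvd cyclic_val_def min_def simp flip: v_def)
  qed simp
  finally show ?thesis .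
qed

section \<open>Units modulo powers of 2\<close>

text \<open>The cofactor of \<open>c - 1\<close> is a sum of an odd number of odd powers, hence
  odd.\<close>

lemma multiplicity_2_odd_power_minus_1:
  fixes c u :: nat
  assumes "odd c" "c > 1" "odd u"
  shows "multiplicity 2 (c ^ u - 1) = multiplicity 2 (c - 1)"
proof -
  define S where "S = (\<Sum>t<u. c ^ t)"
  have "int (c ^ u - 1) = int ((c - 1) * S)"
    using assms(2) power_diff_1_eq[of "int c" u] by (simp add: S_def of_nat_diff)
  then have eq: "c ^ u - 1 = (c - 1) * S" by (simp only: of_nat_eq_iff)
  have "{t \<in> {..<u}. odd (c ^ t)} = {..<u}" using assms(1) by auto
  then have "odd S" using assms(3) by (simp add: S_def even_sum_iff)
  then have "multiplicity 2 S = 0" "S \<noteq> 0" by (auto simp: not_dvd_imp_multiplicity_0 intro!: Nat.gr0I)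
  then show ?thesis
    unfolding eq using assms(2) by (subst prime_elem_multiplicity_mult_distrib) auto
qed

text \<open>The factor \<open>c + 1\<close> is congruent to 2 modulo 4 and contributes exactly one
  2.\<close>

lemma multiplicity_2_square_minus_1:
  fixes c :: nat
  assumes "c mod 4 = 1" "c > 1"
  shows "multiplicity 2 (c\<^sup>2 - 1) = Suc (multiplicity 2 (c - 1))"
proof -
  have eq: "c\<^sup>2 - 1 = (c - 1) * (c + 1)"
    by (simp add: power2_eq_square algebra_simps)
  have "\<exists>w. c + 1 = 2 * w \<and> odd w" using assms(1) by presburger
  then obtain w where w: "c + 1 = 2 * w" "odd w" by blast
  then have "multiplicity 2 (c + 1) = Suc (multiplicity 2 w)"
    by (subst w(1), subst multiplicity_times_same) (auto intro: Nat.gr0I)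
  also have "multiplicity 2 w = 0" using w(2) by (simp add: not_dvd_imp_multiplicity_0)
  finally have "multiplicity 2 (c + 1) = 1" by simp
  then show ?thesis
    unfolding eq using assms(2) by (subst prime_elem_multiplicity_mult_distrib) auto
qed

text \<open>Lifting the exponent: the odd part of \<open>j\<close> leaves the valuation unchanged,
  and each of the remaining squarings adds one, since powers of \<open>b\<close> stay congruent to 1
  modulo 4.\<close>

lemma multiplicity_2_power_minus_1:
  fixes b j :: nat
  assumes b: "b mod 4 = 1" "b > 1" and j: "j > 0"
  shows "multiplicity 2 (b ^ j - 1) = multiplicity 2 (b - 1) + multiplicity 2 j"
proof -
  define v where "v = multiplicity 2 j"
  have "2 ^ v dvd j" unfolding v_def by (rule multiplicity_dvd)
  then obtain u where u: "j = u * 2 ^ v" by (metis dvd_div_mult_self)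
  have "odd u"
  proof
    assume "even u"
    then have "2 ^ Suc v dvd j" unfolding u by (auto elim!: evenE)
    then show False using j power_dvd_iff_le_multiplicity[of j 2 "Suc v"] by (auto simp: v_def)
  qed
  have pow4: "(b ^ i) mod 4 = 1" for i
    using b(1) power_mod[of b 4 i] by simp
  have "odd b" using b(1) by presburger
  have "multiplicity 2 (b ^ (u * 2 ^ r) - 1) = multiplicity 2 (b - 1) + r" for r
  proof (induction r)
    case 0
    then show ?case using multiplicity_2_odd_power_minus_1[OF \<open>odd b\<close> b(2) \<open>odd u\<close>] by simp
  next
    case (Suc r)
    have "u > 0" using \<open>odd u\<close> by (intro Nat.gr0I) simp
    then have "b ^ (u * 2 ^ r) > 1" using b(2) by (intro one_less_power) auto
    from multiplicity_2_square_minus_1[OF pow4 this] Suc.IH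
    have "multiplicity 2 ((b ^ (u * 2 ^ r))\<^sup>2 - 1) = multiplicity 2 (b - 1) + Suc r" by simp
    moreover have "(b ^ (u * 2 ^ r))\<^sup>2 = b ^ (u * 2 ^ Suc r)"
    proof -
      have "u * 2 ^ Suc r = (u * 2 ^ r) * 2" by simp
      then show ?thesis by (simp only: power_mult)
    qed
    ultimately show ?case by simp
  qed
  from this[of v] show ?thesis unfolding u[symmetric] by (simp add: v_def)
qed

lemma gcd_2_power:
  fixes x :: nat
  assumes "x > 0"
  shows "gcd x (2 ^ e) = 2 ^ min e (multiplicity 2 x)"
  using assms by (intro gcd_prime_power_eqI) (auto simp: power_dvd_iff_le_multiplicity)

text \<open>Here \<open>d = 1\<close> stands for a unit \<open>b \<equiv> 1\<close> modulo \<open>4\<close> and \<open>d = 2\<close> for its negative; \<open>2\<^sup>k\<close> is the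
  part of \<open>2\<^sup>e\<close> dividing \<open>b - 1\<close>.\<close>

definition two_val :: "nat \<Rightarrow> nat \<Rightarrow> nat \<Rightarrow> nat \<Rightarrow> nat" where
  "two_val e k d j = (if d = 1 \<or> even j then min e (k + multiplicity 2 j) else 1)"

lemma gcd_power_minus_1_mod_4:
  fixes b :: nat
  assumes b: "b mod 4 = 1" and k: "gcd (b - 1) (2 ^ e) = 2 ^ k" and j: "j > 0"
  shows "gcd (b ^ j - 1) (2 ^ e) = 2 ^ two_val e k 1 j"
proof (cases "b = 1")
  \<comment> \<open>Here \<open>b - 1\<close> is 0, whose \<open>multiplicity\<close> is 0 by
    default, so lifting the exponent does not cover this case.\<close>
  case True
  then have "k = e" using k by simp
  then show ?thesis using True by (simp add: two_val_def)
next
  case False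
  with b have b1: "b > 1" by (cases b) auto
  then have "k = min e (multiplicity 2 (b - 1))" using k gcd_2_power[of "b - 1" e] by simp
  moreover have "b ^ j - 1 > 0" using b1 j using one_less_power[OF b1 j] by simp
  ultimately show ?thesis
    using gcd_2_power[of "b ^ j - 1" e] multiplicity_2_power_minus_1[OF b b1 j]
    by (simp add: two_val_def min_def)
qed

lemma diff_mod_4:
  fixes m b :: nat
  assumes "4 dvd m" "b < m"
  shows "b mod 4 = 1 \<Longrightarrow> (m - b) mod 4 = 3" "b mod 4 = 3 \<Longrightarrow> (m - b) mod 4 = 1"
proof -
  obtain q where q: "m = 4 * q" using assms(1) by blast
  have div: "b = 4 * (b div 4) + b mod 4" by simp
  show "(m - b) mod 4 = 3" if "b mod 4 = 1"
  proof -
    have "m - b = 4 * (q - b div 4 - 1) + 3" using q div that assms(2) by arith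
    then show ?thesis by simp
  qed
  show "(m - b) mod 4 = 1" if "b mod 4 = 3"
  proof -
    have "m - b = 4 * (q - b div 4 - 1) + 1" using q div that assms(2) by arith
    then show ?thesis by simp
  qed
qed

text \<open>For even \<open>j\<close> the sign vanishes and the power agrees with that of
  \<open>b\<close>. For odd \<open>j\<close> the power is congruent to 3 modulo 4, so exactly one
  factor 2 divides it after subtracting 1.\<close>

lemma gcd_power_minus_1_mod_4_neg:
  fixes b :: nat
  assumes b: "b mod 4 = 1" "b < 2 ^ e" and e: "e \<ge> 2"
    and k: "gcd (b - 1) (2 ^ e) = 2 ^ k" and j: "j > 0"
  shows "gcd ((2 ^ e - b) ^ j - 1) (2 ^ e) = 2 ^ two_val e k 2 j"
proof (cases "even j")
  case True
  \<comment> \<open>The passage to integers makes the negative of \<open>b\<close>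
    available.\<close>
  have "[int (2 ^ e - b) = - int b] (mod int (2 ^ e))"
    using b(2) by (simp add: cong_iff_dvd_diff of_nat_diff)
  then have "[int (2 ^ e - b) ^ j = (- int b) ^ j] (mod int (2 ^ e))" by (rule cong_pow)
  then have "[int ((2 ^ e - b) ^ j) = int (b ^ j)] (mod int (2 ^ e))" using True by simp
  then have "[(2 ^ e - b) ^ j = b ^ j] (mod 2 ^ e)" by (simp only: cong_int_iff)
  moreover have "b > 0" using b(1) by (intro Nat.gr0I) simp
  then have "1 \<le> b ^ j" "1 \<le> (2 ^ e - b) ^ j" using b(2) by (simp_all add: Suc_le_eq)
  ultimately have "[(2 ^ e - b) ^ j - 1 = b ^ j - 1] (mod 2 ^ e)"
    by (intro cong_diff_nat) simp_all
  then have "gcd ((2 ^ e - b) ^ j - 1) (2 ^ e) = gcd (b ^ j - 1) (2 ^ e)" by (rule cong_gcd_eq)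
  then show ?thesis using gcd_power_minus_1_mod_4[OF b(1) k j] True by (simp add: two_val_def)
next
  case False
  have "4 dvd (2::nat) ^ e" using le_imp_power_dvd[OF e, of "2::nat"] by simp
  from diff_mod_4(1)[OF this b(2) b(1)] have "(2 ^ e - b) ^ j mod 4 = 3 ^ j mod 4"
    by (metis power_mod)
  also have "(3::nat) ^ j mod 4 = 3"
  proof -
    obtain i where "j = Suc (2 * i)" using False by (metis oddE Suc_eq_plus1)
    moreover have "(9::nat) ^ i mod 4 = 1" using power_mod[of "9::nat" 4 i] by simp
    moreover have "3 * (9::nat) ^ i mod 4 = 3 * (9 ^ i mod 4) mod 4" by (rule mod_mult_right_eq[symmetric])
    moreover have "(3::nat) ^ Suc (2 * i) = 3 * 9 ^ i" by (simp add: power_mult)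
    ultimately show ?thesis by simp
  qed
  finally have 3: "(2 ^ e - b) ^ j mod 4 = 3" .
  define x where "x = (2 ^ e - b) ^ j - 1"
  have "(y - 1) mod 4 = 2" if "y mod 4 = 3" for y :: nat
  proof -
    have "y - 1 = 4 * (y div 4) + 2" using div_mult_mod_eq[of y 4] that by linarith
    then show ?thesis by (simp only: mod_mult_self4) simp
  qed
  from this[OF 3] have x: "x mod 4 = 2" unfolding x_def .
  have "gcd x (2 ^ e) = 2 ^ 1"
  proof (rule gcd_prime_power_eqI)
    fix i :: nat assume "1 \<le> i"
    show "2 ^ i dvd x \<longleftrightarrow> i \<le> 1"
    proof
      assume "2 ^ i dvd x"
      show "i \<le> 1"
      proof (rule ccontr)
        assume "\<not> i \<le> 1"
        then have "(2::nat) ^ 2 dvd 2 ^ i" by (intro le_imp_power_dvd) simp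
        with \<open>2 ^ i dvd x\<close> have "2 ^ 2 dvd x" by (rule dvd_trans[rotated])
        then have "x mod 4 = 0" unfolding dvd_eq_mod_eq_0 by simp
        with x show False by simp
      qed
    next
      assume "i \<le> 1"
      with \<open>1 \<le> i\<close> have "i = 1" by simp
      moreover have "even x" using x by presburger
      ultimately show "2 ^ i dvd x" by simp
    qed
  qed (use e in auto)
  then show ?thesis using False by (simp add: two_val_def x_def)
qed

section \<open>Sorting the units modulo a power of 2\<close>

text \<open>For \<open>k \<ge> 2\<close> a residue \<open>x\<close> whose gcd with the modulus is
  2^k is divisible by 4, so \<open>x + 1\<close> is automatically a unit congruent to 1 modulo 4. It
  remains to count such \<open>x\<close>.\<close>

lemma card_mod_4_gcd:
  fixes e k :: nat
  assumes k: "2 \<le> k" "k \<le> e"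
  shows "card {b \<in> totatives (2 ^ e). b mod 4 = 1 \<and> gcd (b - 1) (2 ^ e) = 2 ^ k} = totient (2 ^ (e - k))"
proof -
  define m where "m = (2::nat) ^ e"
  have four: "4 dvd (2::nat) ^ i" if "i \<ge> 2" for i using le_imp_power_dvd[OF that, of "2::nat"] by simp
  then have m4: "4 dvd m" using k by (simp add: m_def)
  have m1: "m > 1" using k unfolding m_def by (intro one_less_power) auto
  \<comment> \<open>The residue 0 is represented by \<open>m\<close> on the left and corresponds to
    \<open>b = 1\<close>.\<close>
  have "bij_betw (\<lambda>x. x mod m + 1) {x \<in> {0<..m}. gcd x m = 2 ^ k}
      {b \<in> totatives m. b mod 4 = 1 \<and> gcd (b - 1) m = 2 ^ k}"
  proof (rule bij_betw_byWitness[where f' = "\<lambda>b. if b = 1 then m else b - 1"])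
    show "\<forall>x\<in>{x \<in> {0<..m}. gcd x m = 2 ^ k}. (if x mod m + 1 = 1 then m else x mod m + 1 - 1) = x"
      by (auto simp: le_less dest: mod_less)
    show "\<forall>b\<in>{b \<in> totatives m. b mod 4 = 1 \<and> gcd (b - 1) m = 2 ^ k}.
        (if b = 1 then m else b - 1) mod m + 1 = b"
      by (auto simp: in_totatives_iff)
    show "(\<lambda>x. x mod m + 1) ` {x \<in> {0<..m}. gcd x m = 2 ^ k} \<subseteq>
        {b \<in> totatives m. b mod 4 = 1 \<and> gcd (b - 1) m = 2 ^ k}"
    proof safe
      fix x assume x: "x \<in> {0<..m}" "gcd x m = 2 ^ k"
      have "4 dvd gcd x m" using four k x by simp
      then have x4: "4 dvd x mod m" using m4 by (simp add: dvd_mod_iff)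
      have mod4: "(y + 1) mod 4 = 1" "odd (y + 1)" if "4 dvd y" for y :: nat
        using that by presburger+
      from mod4(1)[OF x4] show "(x mod m + 1) mod 4 = 1" .
      have "x mod m + 1 \<le> m" using m1 by (simp add: Suc_le_eq)
      moreover have "odd (x mod m + 1)" using mod4(2)[OF x4] .
      ultimately show "x mod m + 1 \<in> totatives m" by (simp add: in_totatives_iff m_def)
      show "gcd (x mod m + 1 - 1) m = 2 ^ k" using x by simp
    qed
    show "(\<lambda>b. if b = 1 then m else b - 1) ` {b \<in> totatives m. b mod 4 = 1 \<and> gcd (b - 1) m = 2 ^ k}
        \<subseteq> {x \<in> {0<..m}. gcd x m = 2 ^ k}"
      using m1 by (auto simp: in_totatives_iff)
  qed
  then have "card {b \<in> totatives m. b mod 4 = 1 \<and> gcd (b - 1) m = 2 ^ k} = card {x \<in> {0<..m}. gcd x m = 2 ^ k}"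
    by (simp add: bij_betw_same_card)
  also have "\<dots> = totient (m div 2 ^ k)"
    using k by (intro card_gcd_eq_totient) (auto simp: m_def le_imp_power_dvd)
  also have "m div 2 ^ k = 2 ^ (e - k)" using k by (simp add: m_def power_diff)
  finally show ?thesis by (simp add: m_def)
qed

text \<open>Every unit is \<open>b\<close> or \<open>m - b\<close> for a unique unit
  \<open>b\<close> congruent to 1 modulo 4. The summand depends only on this sign and on the gcd of
  \<open>b - 1\<close> with \<open>m\<close>, which is a power 2^k with
  \<open>2 \<le> k \<le> e\<close>.\<close>

lemma sum_totatives_two_power:
  fixes h h1 h2 :: "nat \<Rightarrow> real" and e :: nat
  defines "m \<equiv> 2 ^ e"
  assumes e: "e \<ge> 2"
    and h1: "\<And>b k :: nat. b \<in> totatives m \<Longrightarrow> b mod 4 = 1 \<Longrightarrow> gcd (b - 1) m = 2 ^ k \<Longrightarrow> h b = h1 k"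
    and h2: "\<And>b k :: nat. b \<in> totatives m \<Longrightarrow> b mod 4 = 1 \<Longrightarrow> gcd (b - 1) m = 2 ^ k \<Longrightarrow> h (m - b) = h2 k"
  shows "(\<Sum>a\<in>totatives m. h a) = (\<Sum>k=2..e. real (totient (2 ^ (e - k))) * (h1 k + h2 k))"
proof -
  have m4: "4 dvd m" using le_imp_power_dvd[OF e, of "2::nat"] by (simp add: m_def)
  have m1: "m > 1" using e unfolding m_def by (intro one_less_power) auto
  have tot: "a \<in> totatives m \<longleftrightarrow> a < m \<and> odd a" for a
  proof -
    have "coprime a m \<longleftrightarrow> odd a" using e by (simp add: m_def)
    moreover have "odd a \<longrightarrow> a > 0 \<and> a \<noteq> m" using m4 by presburger
    ultimately show ?thesis by (auto simp: in_totatives_iff)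
  qed
  have mod_4: "odd a \<Longrightarrow> a mod 4 \<noteq> 1 \<Longrightarrow> a mod 4 = 3"
    and odd_1: "a mod 4 = 1 \<Longrightarrow> odd a" and odd_3: "a mod 4 = 3 \<Longrightarrow> odd a" for a :: nat
    by presburger+
  define B where "B = {b \<in> totatives m. b mod 4 = 1}"
  have finB: "finite B" by (simp add: B_def)
  have "(\<Sum>a\<in>totatives m. h a) = (\<Sum>a\<in>B \<union> (totatives m - B). h a)"
    by (intro sum.cong) (auto simp: B_def)
  also have "\<dots> = (\<Sum>a\<in>B. h a) + (\<Sum>a\<in>totatives m - B. h a)"
    by (rule sum.union_disjoint) (auto simp: B_def)
  \<comment> \<open>Reflection interchanges the residue classes 3 and 1 modulo 4.\<close>
  also have "(\<Sum>a\<in>totatives m - B. h a) = (\<Sum>b\<in>B. h (m - b))"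
  proof (rule sum.reindex_bij_witness[where i = "\<lambda>b. m - b" and j = "\<lambda>a. m - a"])
    fix a assume "a \<in> totatives m - B"
    then have a: "a < m" "odd a" "a mod 4 \<noteq> 1"
      using tot[of a] unfolding B_def Diff_iff mem_Collect_eq by blast+
    then have "a > 0" "a mod 4 = 3" using odd_pos mod_4 by blast+
    have "(m - a) mod 4 = 1" using diff_mod_4(2)[OF m4 a(1)] \<open>a mod 4 = 3\<close> by blast
    moreover from this have "odd (m - a)" by (rule odd_1)
    moreover have "m - a < m" using a(1) \<open>a > 0\<close> by linarith
    ultimately show "m - a \<in> B" unfolding B_def mem_Collect_eq tot by blast
    show eq: "m - (m - a) = a" using a(1) by linarith
    show "h (m - (m - a)) = h a" unfolding eq by (rule refl)
  next
    fix b assume "b \<in> B"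
    then have b: "b < m" "b mod 4 = 1" unfolding B_def mem_Collect_eq tot by blast+
    then have "b > 0" by (intro Nat.gr0I) simp
    have "(m - b) mod 4 = 3" using diff_mod_4(1)[OF m4 b] .
    moreover from this have "odd (m - b)" by (rule odd_3)
    moreover have "m - b < m" using b(1) \<open>b > 0\<close> by linarith
    ultimately show "m - b \<in> totatives m - B" unfolding B_def by (simp add: tot)
    show "m - (m - b) = b" using b(1) by linarith
  qed
  also have "(\<Sum>a\<in>B. h a) + (\<Sum>b\<in>B. h (m - b)) = (\<Sum>b\<in>B. h b + h (m - b))"
    by (simp add: sum.distrib)
  \<comment> \<open>Taking the valuation of the gcd rather than of \<open>b - 1\<close> places
    \<open>b = 1\<close> in the class \<open>k = e\<close>.\<close>
  also have "\<dots> = (\<Sum>k\<in>{2..e}. \<Sum>b\<in>{b \<in> B. multiplicity 2 (gcd (b - 1) m) = k}. h b + h (m - b))"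
  proof (rule sum.group[symmetric])
    show "(\<lambda>b. multiplicity 2 (gcd (b - 1) m)) ` B \<subseteq> {2..e}"
    proof clarify
      fix b assume "b \<in> B"
      then have "b mod 4 = 1" by (simp add: B_def)
      then have "b - 1 = 4 * (b div 4)" using div_mult_mod_eq[of b 4] by linarith
      then have "4 dvd b - 1" by simp
      with m4 have "2 ^ 2 dvd gcd (b - 1) m" by simp
      then have "2 \<le> multiplicity 2 (gcd (b - 1) m)"
        using m1 by (subst (asm) power_dvd_iff_le_multiplicity) auto
      moreover have "multiplicity 2 (gcd (b - 1) m) \<le> multiplicity 2 m"
        using m1 by (intro dvd_imp_multiplicity_le) auto
      ultimately show "multiplicity 2 (gcd (b - 1) m) \<in> {2..e}" by (simp add: m_def)
    qed
  qed (use finB in auto)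
  also have "\<dots> = (\<Sum>k=2..e. real (totient (2 ^ (e - k))) * (h1 k + h2 k))"
  proof (rule sum.cong)
    fix k assume k: "k \<in> {2..e}"
    have iff: "multiplicity 2 (gcd (b - 1) m) = k \<longleftrightarrow> gcd (b - 1) m = 2 ^ k" for b
    proof -
      have "gcd (b - 1) m dvd 2 ^ e" unfolding m_def by (rule gcd_dvd2)
      then obtain w where w: "gcd (b - 1) m = 2 ^ w"
        using divides_primepow_nat[OF two_is_prime_nat] by blast
      show ?thesis unfolding w by simp
    qed
    have set_eq: "{b \<in> B. multiplicity 2 (gcd (b - 1) m) = k} =
        {b \<in> totatives m. b mod 4 = 1 \<and> gcd (b - 1) m = 2 ^ k}"
      unfolding iff B_def by blast
    have "(\<Sum>b\<in>{b \<in> B. multiplicity 2 (gcd (b - 1) m) = k}. h b + h (m - b)) =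
        (\<Sum>b\<in>{b \<in> totatives m. b mod 4 = 1 \<and> gcd (b - 1) m = 2 ^ k}. h1 k + h2 k)"
      unfolding set_eq by (intro sum.cong refl arg_cong2[of _ _ _ _ "(+)"] h1 h2) simp_all
    then show "(\<Sum>b\<in>{b \<in> B. multiplicity 2 (gcd (b - 1) m) = k}. h b + h (m - b)) =
        real (totient (2 ^ (e - k))) * (h1 k + h2 k)"
      using card_mod_4_gcd[of k e] k by (simp add: m_def)
  qed simp
  finally show ?thesis .
qed

lemma sum_coprime_2: "(\<Sum>t | t \<in> {1..n} \<and> coprime t (2::nat). l t) = (\<Sum>j=1..n. if odd j then l j else (0::nat))"
  unfolding sum.inter_filter[OF finite_atLeastAtMost, symmetric] by simp

lemma f2_exp_eq_f_exp: "f2_exp e n k 1 l = f_exp 2 e n k 1 l"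
  by (simp add: f2_exp_def f_exp_def)

lemma f2_exp_eq_sum_two_val:
  assumes d: "d \<in> {1, 2}" and k: "2 \<le> k" "k \<le> e"
  shows "f2_exp e n k d l = (\<Sum>j=1..n. two_val e k d j * l j)"
proof (cases "d = 1")
  case True
  then show ?thesis
    using f_exp_eq_sum_cyclic_val[of 2 1 k e n l] k
    by (simp add: f2_exp_eq_f_exp[unfolded One_nat_def] two_val_def cyclic_val_def)
next
  case False
  define A where "A = (\<Sum>t | t \<in> {1..n} \<and> coprime t 2. l t)"
  show ?thesis
  proof (cases "k < e")
    case True
    \<comment> \<open>The odd indices form the layer \<open>s = 0\<close>, with coefficient
      \<open>k\<close>; the second family gives them coefficient 1. The exchange is written
      additively to avoid subtraction.\<close>
    have "f_exp 2 e n k 1 l + A = f2_exp e n k d l + k * A"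
    proof -
      have "{..<e - k} = insert 0 {1..<e - k}" using True by auto
      then show ?thesis using False True by (simp add: f_exp_def f2_exp_def A_def)
    qed
    moreover have "f_exp 2 e n k 1 l + A = (\<Sum>j=1..n. two_val e k d j * l j) + k * A"
    proof -
      have "f_exp 2 e n k 1 l + A = (\<Sum>j=1..n. cyclic_val 2 e k 1 j * l j + (if odd j then l j else 0))"
        using f_exp_eq_sum_cyclic_val[of 2 1 k e n l] k unfolding A_def sum_coprime_2 by (simp add: sum.distrib)
      also have "\<dots> = (\<Sum>j=1..n. two_val e k d j * l j + k * (if odd j then l j else 0))"
        using False k by (intro sum.cong) (auto simp: cyclic_val_def two_val_def not_dvd_imp_multiplicity_0)
      also have "\<dots> = (\<Sum>j=1..n. two_val e k d j * l j) + k * A"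
        unfolding A_def sum_coprime_2 by (simp add: sum.distrib sum_distrib_left)
      finally show ?thesis .
    qed
    ultimately show ?thesis by simp
  next
    case ke: False
    have "f2_exp e n k d l = A + e * (\<Sum>t=1..n div 2. l (t * 2))"
      using False ke by (simp add: f2_exp_def A_def mult.commute)
    also have "\<dots> = (\<Sum>j=1..n. (if odd j then l j else 0) + e * (if 2 dvd j then l j else 0))"
      using sum_multiples[of 2 l n] unfolding A_def sum_coprime_2 by (simp add: sum.distrib sum_distrib_left)
    also have "\<dots> = (\<Sum>j=1..n. two_val e k d j * l j)"
      using False ke k by (intro sum.cong) (auto simp: two_val_def)
    finally show ?thesis .
  qed
qed

section \<open>The counting formulas\<close>

text \<open>If \<open>w l\<close> is the sum of the \<open>v j * l j\<close>, where
  \<open>p ^ v j\<close> is the gcd of \<open>a ^ j - 1\<close> with the modulus, this counts the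
  multisets of \<open>n\<close> pairs of residues fixed by the unit \<open>a\<close>. The doubled
  exponent reflects the two coordinates of a pair.\<close>

definition orbit_average :: "nat \<Rightarrow> nat \<Rightarrow> ((nat \<Rightarrow> nat) \<Rightarrow> nat) \<Rightarrow> real" where
  "orbit_average p n w = (\<Sum>l\<in>cycle_types n. real p ^ (2 * w l) / real (z_cycle n l))"

lemma orbit_average_0: "orbit_average p n (\<lambda>_. 0) = 1"
  by (simp add: orbit_average_def sum_inverse_z_cycle)

lemma sum_cycle_types_gcd:
  fixes a m p n :: nat and v :: "nat \<Rightarrow> nat" and w :: "(nat \<Rightarrow> nat) \<Rightarrow> nat"
  assumes "\<And>j. j > 0 \<Longrightarrow> gcd (a ^ j - 1) m = p ^ v j"
    and "\<And>l. w l = (\<Sum>j=1..n. v j * l j)"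
  shows "(\<Sum>l\<in>cycle_types n. (\<Prod>j=1..n. real (gcd (a ^ j - 1) m) ^ (2 * l j)) / real (z_cycle n l)) =
    orbit_average p n w"
  unfolding orbit_average_def
proof (intro sum.cong refl)
  fix l
  have "(\<Prod>j=1..n. real (gcd (a ^ j - 1) m) ^ (2 * l j)) = (\<Prod>j=1..n. real p ^ (2 * (v j * l j)))"
  proof (intro prod.cong refl)
    fix j assume "j \<in> {1..n}"
    then have "gcd (a ^ j - 1) m = p ^ v j" by (intro assms(1)) simp
    then have "real (gcd (a ^ j - 1) m) ^ (2 * l j) = (real p ^ v j) ^ (2 * l j)"
      by (simp only: of_nat_power)
    also have "\<dots> = real p ^ (v j * (2 * l j))" by (rule power_mult[symmetric])
    also have "v j * (2 * l j) = 2 * (v j * l j)" by simp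
    finally show "real (gcd (a ^ j - 1) m) ^ (2 * l j) = real p ^ (2 * (v j * l j))" .
  qed
  also have "\<dots> = real p ^ (2 * w l)"
    unfolding assms(2) sum_distrib_left by (rule power_sum[symmetric])
  finally show "(\<Prod>j=1..n. real (gcd (a ^ j - 1) m) ^ (2 * l j)) / real (z_cycle n l) =
      real p ^ (2 * w l) / real (z_cycle n l)" by simp
qed

text \<open>Units of equal order contribute equally. The orders are d p^s with \<open>d\<close>
  dividing \<open>p - 1\<close>, each attained by \<open>totient d * totient (p ^ s)\<close> units,
  and \<open>k = e - s\<close>.\<close>

lemma sum_totatives_cyclic:
  fixes p e n :: nat
  assumes p: "Factorial_Ring.prime p" and e: "e \<ge> 1" and cyc: "odd p \<or> e \<le> 2"
  shows "(\<Sum>a\<in>totatives (p ^ e). \<Sum>l\<in>cycle_types n.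
      (\<Prod>j=1..n. real (gcd (a ^ j - 1) (p ^ e)) ^ (2 * l j)) / real (z_cycle n l)) =
    (\<Sum>k=1..e. real (totient (p ^ (e - k))) *
      (\<Sum>d | d dvd p - 1. real (totient d) * orbit_average p n (f_exp p e n k d)))"
proof -
  define m where "m = p ^ e"
  define F where "F = (\<lambda>a. \<Sum>l\<in>cycle_types n.
      (\<Prod>j=1..n. real (gcd (a ^ j - 1) m) ^ (2 * l j)) / real (z_cycle n l))"
  define q where "q = p - 1"
  have p1: "p > 1" using p by (rule prime_gt_1_nat)
  have q: "q > 0" using p1 by (simp add: q_def)
  have m1: "m > 1" unfolding m_def using p1 e by (intro one_less_power) auto
  have tot: "totient m = p ^ (e - 1) * q" using p e by (simp add: m_def q_def totient_prime_power)
  \<comment> \<open>The case assumption enters here: odd prime powers, 2 and 4 have primitive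
    roots.\<close>
  have "m \<in> cyclic_moduli"
  proof (cases "odd p")
    case True
    then have "p ^ e \<in> {p ^ k |p k. Factorial_Ring.prime p \<and> odd p \<and> k > 0}" using p e True by (intro CollectI exI[of _ p] exI[of _ e]) simp
    then show ?thesis unfolding cyclic_moduli_def m_def by blast
  next
    case False
    then have "p = 2" using p primes_dvd_imp_eq[of 2 p] by simp
    moreover have "e = 1 \<or> e = 2" using e cyc False by auto
    ultimately show ?thesis unfolding cyclic_moduli_def m_def by auto
  qed
  then obtain g where g: "residue_primroot m g" using residue_primroot_iff_in_cyclic_moduli by blast
  have "(\<Sum>a\<in>totatives m. F a) =
      (\<Sum>D\<in>{D. D dvd totient m}. \<Sum>a\<in>{a \<in> totatives m. ord m a = D}. F a)"
  proof (rule sum.group[symmetric])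
    show "finite {D. D dvd totient m}" using m1 by (intro finite_divisors_nat) simp
    show "ord m ` totatives m \<subseteq> {D. D dvd totient m}"
      by (auto simp: in_totatives_iff coprime_commute intro: order_divides_totient)
  qed simp
  also have "\<dots> = (\<Sum>s\<le>e - 1. \<Sum>d | d dvd q. \<Sum>a\<in>{a \<in> totatives m. ord m a = d * p ^ s}. F a)"
    unfolding tot
    using coprime_dvd_pred[OF p1, of q]
    by (intro sum_divisors_coprime_prime_power[OF p]) (simp add: q_def)
  also have "\<dots> = (\<Sum>s\<le>e - 1. \<Sum>d | d dvd q.
      real (totient d) * real (totient (p ^ s)) * orbit_average p n (f_exp p e n (e - s) d))"
  proof (intro sum.cong refl)
    fix s d assume "s \<in> {..e - 1}" and "d \<in> {d. d dvd q}"
    then have s: "s \<le> e - 1" and d: "d dvd p - 1" by (auto simp: q_def)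
    have d0: "d > 0" using d p1 by (intro Nat.gr0I) simp
    have cop: "coprime d p" by (rule coprime_dvd_pred[OF p1 d])
    have k: "1 \<le> e - s" "e - s \<le> e" and s': "e - (e - s) = s" using s e by auto
    have F_eq: "F a = orbit_average p n (f_exp p e n (e - s) d)"
      if a: "a \<in> totatives m" "ord m a = d * p ^ s" for a
      unfolding F_def
    proof (rule sum_cycle_types_gcd)
      show "gcd (a ^ j - 1) m = p ^ cyclic_val p e (e - s) d j" if "j > 0" for j
        unfolding m_def
        by (rule gcd_power_minus_1_cyclic[OF p g[unfolded m_def] a(1)[unfolded m_def] k d _ that])
           (simp only: s' a(2)[unfolded m_def])
      show "f_exp p e n (e - s) d l = (\<Sum>j=1..n. cyclic_val p e (e - s) d j * l j)" for l
        by (rule f_exp_eq_sum_cyclic_val[OF p cop d0 k(2)])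
    qed
    have "d * p ^ s dvd totient m"
      unfolding tot mult.commute[of "p ^ (e - 1)"]
      using d s by (intro mult_dvd_mono le_imp_power_dvd) (auto simp: q_def)
    from card_elements_with_ord_primroot[OF m1 g this]
    have "(\<Sum>a\<in>{a \<in> totatives m. ord m a = d * p ^ s}. F a) =
        real (totient (d * p ^ s)) * orbit_average p n (f_exp p e n (e - s) d)"
      using F_eq by simp
    moreover have "totient (d * p ^ s) = totient d * totient (p ^ s)"
      using cop by (intro totient_mult_coprime) simp
    ultimately show "(\<Sum>a\<in>{a \<in> totatives m. ord m a = d * p ^ s}. F a) =
        real (totient d) * real (totient (p ^ s)) * orbit_average p n (f_exp p e n (e - s) d)"
      by simp
  qed
  also have "\<dots> = (\<Sum>k=1..e. \<Sum>d | d dvd q.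
      real (totient d) * real (totient (p ^ (e - k))) * orbit_average p n (f_exp p e n k d))"
    by (rule sum.reindex_bij_witness[where i = "\<lambda>k. e - k" and j = "\<lambda>s. e - s"]) (use e in auto)
  also have "\<dots> = (\<Sum>k=1..e. real (totient (p ^ (e - k))) *
      (\<Sum>d | d dvd q. real (totient d) * orbit_average p n (f_exp p e n k d)))"
    by (simp add: sum_distrib_left mult_ac)
  finally show ?thesis by (simp only: F_def m_def q_def)
qed

lemma sum_totatives_two:
  fixes e n :: nat
  assumes e: "e \<ge> 2"
  shows "(\<Sum>a\<in>totatives (2 ^ e). \<Sum>l\<in>cycle_types n.
      (\<Prod>j=1..n. real (gcd (a ^ j - 1) (2 ^ e)) ^ (2 * l j)) / real (z_cycle n l)) =
    (\<Sum>k=2..e. real (totient (2 ^ (e - k))) *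
      (orbit_average 2 n (f2_exp e n k 1) + orbit_average 2 n (f2_exp e n k 2)))"
proof (rule sum_totatives_two_power[OF e])
  fix b k :: nat
  assume b: "b \<in> totatives (2 ^ e)" "b mod 4 = 1" and gcd_b: "gcd (b - 1) (2 ^ e) = 2 ^ k"
  have "(2::nat) ^ k dvd 2 ^ e" unfolding gcd_b[symmetric] by (rule gcd_dvd2)
  then have ke: "k \<le> e" by (rule power_dvd_imp_le) simp
  \<comment> \<open>As 4 divides both \<open>b - 1\<close> and the modulus, it divides their gcd,
    whence \<open>k \<ge> 2\<close>.\<close>
  have "b - 1 = 4 * (b div 4)" using div_mult_mod_eq[of b 4] b(2) by linarith
  then have "2 ^ 2 dvd b - 1" by simp
  moreover have "(2::nat) ^ 2 dvd 2 ^ e" using e by (rule le_imp_power_dvd)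
  ultimately have "2 ^ 2 dvd gcd (b - 1) (2 ^ e)" by (rule gcd_greatest)
  then have "2 ^ 2 dvd (2::nat) ^ k" unfolding gcd_b .
  then have k2: "2 \<le> k" by (rule power_dvd_imp_le) simp
  show "(\<Sum>l\<in>cycle_types n. (\<Prod>j=1..n. real (gcd (b ^ j - 1) (2 ^ e)) ^ (2 * l j)) / real (z_cycle n l)) =
      orbit_average 2 n (f2_exp e n k 1)"
    by (rule sum_cycle_types_gcd[where v = "two_val e k 1"])
       (use gcd_power_minus_1_mod_4[OF b(2) gcd_b] f2_exp_eq_sum_two_val[OF _ k2 ke] in auto)
  have "b \<noteq> 2 ^ e"
  proof
    assume "b = 2 ^ e"
    then have "even b" using e by simp
    with b(2) show False by presburger
  qed
  then have "b < 2 ^ e" using b(1) by (simp add: in_totatives_iff)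
  then show "(\<Sum>l\<in>cycle_types n. (\<Prod>j=1..n. real (gcd ((2 ^ e - b) ^ j - 1) (2 ^ e)) ^ (2 * l j)) / real (z_cycle n l)) =
      orbit_average 2 n (f2_exp e n k 2)"
    by (intro sum_cycle_types_gcd[where v = "two_val e k 2"])
       (use gcd_power_minus_1_mod_4_neg[OF b(2) _ e gcd_b] f2_exp_eq_sum_two_val[OF _ k2 ke] in auto)
qed

section \<open>Choice of a generator and assembly of the formulas\<close>

lemma cyclic_with_root_exists:
  fixes G :: "('a, 'c) monoid_scheme" and F :: "('b, 'd) ring_scheme" and m :: nat
  assumes "group G" "cyclic_group G" "Coset.order G = m" "m > 1" "field F"
    and "primitive_root_of_one F m \<zeta>"
  obtains g where "cyclic_with_root G F m g \<zeta>"
proof -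
  interpret group G by fact
  obtain g where g: "g \<in> carrier G" "subgroup_generated G {g} = G"
    using assms(2) unfolding cyclic_group_def by blast
  have ord_g: "ord g = m" using cyclic_order_is_ord[OF g(1)] g(2) assms(3) by simp
  have fin: "finite (carrier G)" using assms(3,4) by (simp add: Coset.order_def card_ge_0_finite)
  have "inj_on (\<lambda>i::nat. g [^]\<^bsub>G\<^esub> i) {..<m}"
    by (rule inj_onI) (simp add: nat_pow_eq_iff[OF g(1)] ord_g cong_less_modulus_unique_nat)
  then have "card ((\<lambda>i::nat. g [^]\<^bsub>G\<^esub> i) ` {..<m}) = card (carrier G)"
    using assms(3) by (simp add: card_image Coset.order_def)
  then have "(\<lambda>i::nat. g [^]\<^bsub>G\<^esub> i) ` {..<m} = carrier G"
    using g(1) fin by (intro card_subset_eq) auto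
  then have "cyclic_with_root G F m g \<zeta>"
    using assms g ord_g by (auto simp: cyclic_with_root_def cyclic_with_root_axioms_def)
  then show thesis by (rule that)
qed

text \<open>All ranges are empty because p^s d is at least \<open>d\<close>. For such
  \<open>d\<close> the average is 1, which removes the terms with \<open>d > n\<close> from the
  second form.\<close>

lemma f_exp_eq_0:
  assumes "n < d" "p > 0"
  shows "f_exp p e n k d l = 0"
proof -
  have "n div (p ^ s * d) = 0" for s
  proof -
    have "1 * d \<le> p ^ s * d" using assms(2) by (intro mult_le_mono1) (simp add: Suc_le_eq)
    with assms(1) have "n < p ^ s * d" by linarith
    then show ?thesis by (rule div_less)
  qed
  then show ?thesis unfolding f_exp_def by simp
qed

theorem theorem2p4:
  fixes G :: "('a, 'c) monoid_scheme" and F :: "('b, 'd) ring_scheme" and p e n :: nat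
  assumes "Factorial_Ring.prime p" and "e \<ge> 1" and "n \<ge> 1"
    and "group G" and "cyclic_group G" and "Coset.order G = p ^ e"
    and "field F" and "\<exists>\<zeta>. primitive_root_of_one F (p ^ e) \<zeta>"
  shows
    "(odd p \<or> e \<le> 2 \<longrightarrow>
       real (num_ESC_classes G F n) =
         1 / (real p ^ (e - 1) * (real p - 1)) *
           (\<Sum>d | d dvd p - 1. real (totient d) *
             (\<Sum>l\<in>cycle_types n. real p ^ (2 * f_exp p e n e d l) / real (z_cycle n l)))
         + (\<Sum>k = 1..e - 1. 1 / real p ^ k *
             (\<Sum>d | d dvd p - 1. real (totient d) *
               (\<Sum>l\<in>cycle_types n. real p ^ (2 * f_exp p e n k d l) / real (z_cycle n l))))
       \<and>
       real (num_ESC_classes G F n) =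
         1 + 1 / (real p ^ (e - 1) * (real p - 1)) *
           (\<Sum>d | d dvd p - 1 \<and> d \<le> n. real (totient d) *
             ((\<Sum>l\<in>cycle_types n.
                 real p ^ (2 * e * (\<Sum>t = 1..n div d. l (t * d))) / real (z_cycle n l)) - 1))
         + (\<Sum>k = 1..e - 1. 1 / real p ^ k *
             (\<Sum>d | d dvd p - 1 \<and> d \<le> n. real (totient d) *
               ((\<Sum>l\<in>cycle_types n.
                   real p ^ (2 * f_exp p e n k d l) / real (z_cycle n l)) - 1))))
     \<and>
     (p = 2 \<and> e \<ge> 3 \<longrightarrow>
       real (num_ESC_classes G F n) =
         (\<Sum>d = 1..2. \<Sum>k = 2..e. real (totient (2 ^ (e - k))) / 2 ^ (e - 1) *
           (\<Sum>l\<in>cycle_types n. 4 ^ f2_exp e n k d l / real (z_cycle n l)))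
       \<and>
       real (num_ESC_classes G F n) =
         1 / 2 ^ (e - 1) *
           (\<Sum>l\<in>cycle_types n.
             (4 ^ (e * (\<Sum>t = 1..n. l t))
              + 4 ^ ((\<Sum>t | t \<in> {1..n} \<and> coprime t 2. l t) + e * (\<Sum>t = 1..n div 2. l (2 * t))))
             / real (z_cycle n l))
         + (\<Sum>d = 1..2. \<Sum>k = 2..e - 1. 1 / 2 ^ k *
             (\<Sum>l\<in>cycle_types n. 4 ^ f2_exp e n k d l / real (z_cycle n l))))"
proof -
  have p1: "p > 1" using assms(1) by (rule prime_gt_1_nat)
  have m1: "p ^ e > 1" using p1 assms(2) by (intro one_less_power) auto
  obtain \<zeta> where \<zeta>: "primitive_root_of_one F (p ^ e) \<zeta>" using assms(8) by blast
  obtain g where "cyclic_with_root G F (p ^ e) g \<zeta>"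
    using cyclic_with_root_exists[OF assms(4-6) m1 assms(7) \<zeta>] by blast
  then interpret cyclic_with_root G F "p ^ e" g \<zeta> .
  define N where "N = real (num_ESC_classes G F n)"
  define A where "A = (\<lambda>k d. orbit_average p n (f_exp p e n k d))"
  define A2 where "A2 = (\<lambda>k d. orbit_average 2 n (f2_exp e n k d))"
  have tot: "real (totient (p ^ i)) = real p ^ (i - 1) * (real p - 1)" if "i > 0" for i
    using that assms(1) p1 by (simp add: totient_prime_power of_nat_diff)
  define c where "c = real p ^ (e - 1) * (real p - 1)"
  have c: "c > 0" "real (totient (p ^ e)) = c"
    using p1 tot[of e] assms(2) by (auto simp: c_def)
  have part1: "N = 1 / c * (\<Sum>d | d dvd p - 1. real (totient d) * A e d) +
      (\<Sum>k=1..e - 1. 1 / real p ^ k * (\<Sum>d | d dvd p - 1. real (totient d) * A k d))"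
    if cyc: "odd p \<or> e \<le> 2"
  proof -
    have "c * N = (\<Sum>k=1..e. real (totient (p ^ (e - k))) * (\<Sum>d | d dvd p - 1. real (totient d) * A k d))"
      using num_ESC_classes_formula[of n] sum_totatives_cyclic[OF assms(1,2) cyc, of n]
      by (simp add: c(2) N_def A_def)
    \<comment> \<open>For \<open>k < e\<close> the totient of p^(e-k) is that of p^e divided by p^k;
      at \<open>k = e\<close> it is 1, so this term stands apart.\<close>
    also have "{1..e} = insert e {1..e - 1}" using assms(2) by auto
    also have "(\<Sum>k\<in>insert e {1..e - 1}. real (totient (p ^ (e - k))) * (\<Sum>d | d dvd p - 1. real (totient d) * A k d)) =
        (\<Sum>d | d dvd p - 1. real (totient d) * A e d) +
        (\<Sum>k=1..e - 1. c / real p ^ k * (\<Sum>d | d dvd p - 1. real (totient d) * A k d))"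
    proof -
      have "real (totient (p ^ (e - k))) = c / real p ^ k" if "k \<in> {1..e - 1}" for k
      proof -
        have "e - 1 = (e - k - 1) + k" using that by auto
        then have "real p ^ (e - 1) = real p ^ (e - k - 1) * real p ^ k" by (metis power_add)
        then show ?thesis using tot[of "e - k"] that p1 by (auto simp: c_def)
      qed
      then show ?thesis using assms(2) by simp
    qed
    also have "\<dots> = c * (1 / c * (\<Sum>d | d dvd p - 1. real (totient d) * A e d) +
        (\<Sum>k=1..e - 1. 1 / real p ^ k * (\<Sum>d | d dvd p - 1. real (totient d) * A k d)))"
    proof -
      have "c * (1 / c * x) = x" for x using c(1) by simp
      moreover have "c * (\<Sum>k=1..e - 1. 1 / real p ^ k * y k) = (\<Sum>k=1..e - 1. c / real p ^ k * y k)" for y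
        unfolding sum_distrib_left by (intro sum.cong refl) simp
      ultimately show ?thesis by (simp only: distrib_left)
    qed
    finally show ?thesis using c(1) mult_left_cancel[of c] by blast
  qed
  have part2: "N = 1 + 1 / c * (\<Sum>d | d dvd p - 1 \<and> d \<le> n. real (totient d) * (A e d - 1)) +
      (\<Sum>k=1..e - 1. 1 / real p ^ k * (\<Sum>d | d dvd p - 1 \<and> d \<le> n. real (totient d) * (A k d - 1)))"
    if cyc: "odd p \<or> e \<le> 2"
  proof -
    \<comment> \<open>The value 1 is taken out of every average; the totients of the divisors of
      \<open>p - 1\<close> add up to \<open>p - 1\<close>.\<close>
    have split: "(\<Sum>d | d dvd p - 1. real (totient d) * A k d) =
        (real p - 1) + (\<Sum>d | d dvd p - 1 \<and> d \<le> n. real (totient d) * (A k d - 1))" for k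
    proof -
      have fin: "finite {d. d dvd p - 1}" using p1 by (intro finite_divisors_nat) simp
      have "(\<Sum>d | d dvd p - 1. real (totient d) * A k d) =
          (\<Sum>d | d dvd p - 1. real (totient d)) + (\<Sum>d | d dvd p - 1. real (totient d) * (A k d - 1))"
        by (simp add: algebra_simps flip: sum.distrib)
      also have "(\<Sum>d | d dvd p - 1. real (totient d)) = real p - 1"
        using totient_divisor_sum[of "p - 1"] p1 by (simp add: of_nat_diff flip: of_nat_sum)
      also have "(\<Sum>d | d dvd p - 1. real (totient d) * (A k d - 1)) =
          (\<Sum>d | d dvd p - 1 \<and> d \<le> n. real (totient d) * (A k d - 1))"
      proof (rule sum.mono_neutral_right[OF fin])
        show "\<forall>d\<in>{d. d dvd p - 1} - {d. d dvd p - 1 \<and> d \<le> n}. real (totient d) * (A k d - 1) = 0"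
        proof
          fix d assume "d \<in> {d. d dvd p - 1} - {d. d dvd p - 1 \<and> d \<le> n}"
          then have "f_exp p e n k d = (\<lambda>_. 0)" using p1 by (intro ext f_exp_eq_0) auto
          then show "real (totient d) * (A k d - 1) = 0" by (simp add: A_def orbit_average_0)
        qed
      qed auto
      finally show ?thesis .
    qed
    \<comment> \<open>The parts taken out form a geometric series, which together with the term for
      \<open>k = e\<close> adds up to the leading 1.\<close>
    have geom: "(real p - 1) * (\<Sum>k=1..r. 1 / real p ^ k) = 1 - 1 / real p ^ r" for r
    proof (induction r)
      case (Suc r)
      then show ?case using p1 by (simp add: distrib_left field_simps)
    qed simp
    have "1 / c * (real p - 1) = 1 / real p ^ (e - 1)" using p1 by (simp add: c_def)
    moreover have "(\<Sum>k=1..e - 1. 1 / real p ^ k * (real p - 1)) = 1 - 1 / real p ^ (e - 1)"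
      unfolding geom[symmetric] sum_distrib_left by (simp only: mult.commute)
    ultimately have "1 / c * (real p - 1) + (\<Sum>k=1..e - 1. 1 / real p ^ k * (real p - 1)) = 1"
      by simp
    then show ?thesis
      unfolding part1[OF cyc] split distrib_left sum.distrib by linarith
  qed
  have part3: "N = (\<Sum>d=1..2. \<Sum>k=2..e. real (totient (2 ^ (e - k))) / 2 ^ (e - 1) * A2 k d)"
    if p2: "p = 2" and e3: "e \<ge> 3"
  proof -
    have "c * N = (\<Sum>k=2..e. real (totient (2 ^ (e - k))) * (A2 k 1 + A2 k 2))"
      using num_ESC_classes_formula[of n] sum_totatives_two[of e n] e3 c(2)
      by (simp add: N_def A2_def p2)
    moreover have "c = 2 ^ (e - 1)" by (simp add: c_def p2)
    ultimately have "N = (\<Sum>k=2..e. real (totient (2 ^ (e - k))) * (A2 k 1 + A2 k 2)) / 2 ^ (e - 1)"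
      by (simp add: eq_divide_eq mult.commute)
    also have "\<dots> = (\<Sum>k=2..e. real (totient (2 ^ (e - k))) / 2 ^ (e - 1) * (A2 k 1 + A2 k 2))"
      unfolding sum_divide_distrib by (intro sum.cong refl) simp
    also have "\<dots> = (\<Sum>d\<in>{1, 2}. \<Sum>k=2..e. real (totient (2 ^ (e - k))) / 2 ^ (e - 1) * A2 k d)"
      by (simp add: distrib_left sum.distrib)
    also have "{1, 2::nat} = {1..2}" by auto
    finally show ?thesis .
  qed
  have part4: "N = 1 / 2 ^ (e - 1) * (A2 e 1 + A2 e 2) + (\<Sum>d=1..2. \<Sum>k=2..e - 1. 1 / 2 ^ k * A2 k d)"
    if p2: "p = 2" and e3: "e \<ge> 3"
  proof -
    \<comment> \<open>The totient of 2^(e-k) is 2^(e-k-1) for \<open>k < e\<close> but 1 for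
      \<open>k = e\<close>, which is why that term is listed separately.\<close>
    have coeff: "real (totient (2 ^ (e - k))) / 2 ^ (e - 1) = 1 / 2 ^ k" if "k \<in> {2..e - 1}" for k
    proof -
      have "e - 1 = (e - k - 1) + k" using that by auto
      then have "(2::real) ^ (e - 1) = 2 ^ (e - k - 1) * 2 ^ k" by (metis power_add)
      then show ?thesis using tot[of "e - k"] that e3 p2 by auto
    qed
    have "(\<Sum>k=2..e. real (totient (2 ^ (e - k))) / 2 ^ (e - 1) * A2 k d) =
        1 / 2 ^ (e - 1) * A2 e d + (\<Sum>k=2..e - 1. 1 / 2 ^ k * A2 k d)" for d
    proof -
      have "{2..e} = insert e {2..e - 1}" using e3 by auto
      then have "(\<Sum>k=2..e. real (totient (2 ^ (e - k))) / 2 ^ (e - 1) * A2 k d) =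
          1 / 2 ^ (e - 1) * A2 e d + (\<Sum>k=2..e - 1. real (totient (2 ^ (e - k))) / 2 ^ (e - 1) * A2 k d)"
        using e3 by simp
      also have "(\<Sum>k=2..e - 1. real (totient (2 ^ (e - k))) / 2 ^ (e - 1) * A2 k d) =
          (\<Sum>k=2..e - 1. 1 / 2 ^ k * A2 k d)"
        using coeff by (intro sum.cong refl arg_cong2[of _ _ _ _ "(*)"]) auto
      finally show ?thesis .
    qed
    moreover have "{1..2} = {1, 2::nat}" by auto
    ultimately show ?thesis
      unfolding part3[OF p2 e3] by (simp add: add_divide_distrib)
  qed
  have avg_4: "orbit_average 2 n w = (\<Sum>l\<in>cycle_types n. 4 ^ w l / real (z_cycle n l))" for w
    by (simp add: orbit_average_def power_mult)
  \<comment> \<open>At \<open>k = e\<close> the sum over \<open>s\<close> is empty and the power of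
    \<open>p\<close> in the last sum is 1.\<close>
  have f_e: "2 * f_exp p e n e d l = 2 * e * (\<Sum>t=1..n div d. l (t * d))" for d l
    by (simp add: f_exp_def)
  have f2_e: "f2_exp e n e 1 l = e * (\<Sum>t=1..n. l t)"
    "f2_exp e n e 2 l = (\<Sum>t | t \<in> {1..n} \<and> coprime t 2. l t) + e * (\<Sum>t = 1..n div 2. l (2 * t))" for l
    by (simp_all add: f2_exp_def)
  have A2_e: "A2 e 1 + A2 e 2 = (\<Sum>l\<in>cycle_types n. (4 ^ (e * (\<Sum>t = 1..n. l t))
      + 4 ^ ((\<Sum>t | t \<in> {1..n} \<and> coprime t 2. l t) + e * (\<Sum>t = 1..n div 2. l (2 * t))))
      / real (z_cycle n l))"
    unfolding A2_def avg_4 f2_e by (simp only: add_divide_distrib sum.distrib)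
  show ?thesis
  proof (intro conjI impI, goal_cases)
    case 1
    then show ?case using part1 unfolding N_def c_def A_def orbit_average_def by (simp only:)
  next
    case 2
    then show ?case using part2 unfolding N_def c_def A_def orbit_average_def f_e by (simp only:)
  next
    case 3
    then show ?case using part3 unfolding N_def A2_def avg_4 by (simp only:)
  next
    case 4
    then show ?case using part4 unfolding N_def A2_e unfolding A2_def avg_4 by (simp only:)
  qed
qed

end
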